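(* Let $1\le k\leq m-1$ be integers. The Hilbert measure on $\boldsymbol{u}(V_k)\simeq V_k/\operatorname{SO}_m$ (for the group $\operatorname{SO}_m$) coincides with $$\lambda_{k,m}(\boldsymbol{u})\, d\boldsymbol{u} = \frac{|G_k|^{(m-k-1)/2}}{2^{k}}\prod_{j=1}^{k}\operatorname{Vol}(S^{m-j})\; d\boldsymbol{u} = \frac{1}{2^{k}}\operatorname{Vol}(\operatorname{O}_{m}/\operatorname{O}_{m-k})\,|G_k|^{(m-k-1)/2}\, d\boldsymbol{u}.$$
   Context: $\operatorname{O}_m=\operatorname{O}_m(\mathbb{R})$ is the real orthogonal group and $\operatorname{SO}_m$ the special orthogonal group. $V_k=\mathbb{R}^{mk}=(\mathbb{R}^m)^k$ carries the diagonal action $A(\boldsymbol{v}_1,\ldots,\boldsymbol{v}_k)=(A\boldsymbol{v}_1,\ldots,A\boldsymbol{v}_k)$, with $\boldsymbol{v}_i\in\mathbb{R}^m$. The Hilbert embedding is the map $$\boldsymbol{u}=(u_{i,j})_{1\le j\le i\le k}\colon V_k\to\mathbb{R}^{\binom{k+1}{2}},\qquad u_{i,j}=u_{j,i}=\langle\boldsymbol{v}_i,\boldsymbol{v}_j\rangle$$ (standard inner product); for $k\le m-1$ the $\operatorname{SO}_m$- and $\operatorname{O}_m$-invariant polynomials on $V_k$ coincide, and $\boldsymbol{u}$ induces an identification of $V_k/\operatorname{SO}_m=V_k/\operatorname{O}_m$ with the image $\boldsymbol{u}(V_k)$. The symbols $u_{i,j}$ with $u_{i,j}=u_{j,i}$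 also denote the coordinates on $\mathbb{R}^{\binom{k+1}{2}}$, $G_k=(u_{i,j})_{i,j\in\{1,\ldots,k\}}$ is the corresponding symmetric $k\times k$ matrix (Gram matrix), $|G_k|$ is its determinant, and $d\boldsymbol{u}=\prod_{1\le j\le i\le k}du_{i,j}$ is Lebesgue measure on $\mathbb{R}^{\binom{k+1}{2}}$. The Hilbert measure on $\boldsymbol{u}(V_k)$ for the group $\operatorname{SO}_m$ is the measure $\lambda(\boldsymbol{u})\,d\boldsymbol{u}$ uniquely determined by the condition that $$\int_{V_k} f(\boldsymbol{v}_1,\ldots,\boldsymbol{v}_k)\,d\boldsymbol{v}_1\cdots d\boldsymbol{v}_k=\int_{\boldsymbol{u}(V_k)}F(\boldsymbol{u})\,\lambda(\boldsymbol{u})\,d\boldsymbol{u}$$ for each compactly supported smooth $\operatorname{SO}_m$-invariant function $f\in\mathcal{C}_c^\infty(V_k)^{\operatorname{SO}_m}$, where $d\boldsymbol{v}_i$ is Lebesgue measure on the $i$th copy of $\mathbb{R}^m$ and $F\in\mathcal{C}_c^\infty(\mathbb{R}^{\binom{k+1}{2}})$ is such that $f(\boldsymbol{v}_1,\ldots,\boldsymbol{v}_k)=F(\boldsymbol{u}(\boldsymbol{v}_1,\ldots,\boldsymbol{v}_k))$. Volumes: $\operatorname{Vol}(S^{n-1})=\frac{2\pi^{n/2}}{\Gamma(n/2)}$ is the volume of the unit sphere in $\mathbb{R}^n$ for $n\ge1$. The volume of the orthogonal group is normalized as $\operatorname{Vol}(\operatorname{O}_n)=\frac{2^n\sqrt{\pi}^{\binom{n+1}{2}}}{\prod_{j=1}^n\Gamma(j/2)}$,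 and $\operatorname{Vol}(\operatorname{O}_m/\operatorname{O}_{m-k})=\operatorname{Vol}(\operatorname{O}_m)/\operatorname{Vol}(\operatorname{O}_{m-k})$ is the volume of the Stiefel manifold $\operatorname{O}_m/\operatorname{O}_{m-k}$. *)

theory Defs
  imports "HOL-Analysis.Analysis" "HOL-Library.Uprod"
begin

text \<open>
  A point of \<open>V\<^sub>k = (\<real>\<^sup>m)\<^sup>k\<close> is an element of \<^typ>\<open>real^'m^'k\<close> with \<open>m = CARD('m)\<close> and
  \<open>k = CARD('k)\<close>. Since \<open>u\<^sub>i\<^sub>j = u\<^sub>j\<^sub>i\<close>, the coordinates on the target of the Hilbert embedding
  are indexed by unordered pairs (with \<open>i = j\<close> allowed), of which there are
  \<open>k (k + 1) div 2\<close> (\<open>card_UNIV_uprod\<close>); the Lebesgue measure \<open>du\<close> is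
  \<^const>\<open>lborel\<close> on \<^typ>\<open>real^('k uprod)\<close>.
\<close>

instance uprod :: (finite) finite
  by standard simp

lift_definition inner_commute :: "real^'m::finite^'k::finite \<Rightarrow> ('k, real) commute"
  is "\<lambda>v i j. (v $ i) \<bullet> (v $ j)"
  by (simp add: inner_commute)

definition hilbert_map :: "real^'m::finite^'k::finite \<Rightarrow> real^('k::finite uprod)" where
  "hilbert_map v = (\<chi> p. case_uprod (inner_commute v) p)"

lemma hilbert_map_Upair [simp]: "hilbert_map v $ Upair i j = (v $ i) \<bullet> (v $ j)"
  by (simp add: hilbert_map_def inner_commute.rep_eq)

definition gram_matrix :: "real^('k::finite uprod) \<Rightarrow> real^'k^'k" where
  "gram_matrix u = (\<chi> i j. u $ Upair i j)"

primrec n_times_cont_diff :: "nat \<Rightarrow> ('a::euclidean_space \<Rightarrow> real) \<Rightarrow> bool" where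
  "n_times_cont_diff 0 f \<longleftrightarrow> continuous_on UNIV f"
| "n_times_cont_diff (Suc n) f \<longleftrightarrow>
     (\<forall>x. f differentiable at x) \<and>
     (\<forall>b\<in>Basis. n_times_cont_diff n (\<lambda>x. frechet_derivative f (at x) b))"

definition smooth_compact_support :: "('a::euclidean_space \<Rightarrow> real) \<Rightarrow> bool" where
  "smooth_compact_support f \<longleftrightarrow>
     (\<forall>n. n_times_cont_diff n f) \<and> compact (closure {x. f x \<noteq> 0})"

definition SO_invariant :: "(real^'m::finite^'k::finite \<Rightarrow> real) \<Rightarrow> bool" where
  "SO_invariant f \<longleftrightarrow>
     (\<forall>A::real^'m^'m. rotation_matrix A \<longrightarrow> (\<forall>v. f (\<chi> i. A *v (v $ i)) = f v))"

definition hilbert_image :: "'m::finite itself \<Rightarrow> (real^('k::finite uprod)) set" where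
  "hilbert_image (_ :: 'm::finite itself) = range (hilbert_map :: real^'m^'k \<Rightarrow> _)"

definition density_on_image ::
    "'m::finite itself \<Rightarrow> (real^('k::finite uprod) \<Rightarrow> real) \<Rightarrow> (real^('k::finite uprod)) measure" where
  "density_on_image T l =
     density (restrict_space lborel (hilbert_image T)) (\<lambda>u. ennreal (l u))"

text \<open>
  The defining property of the Hilbert measure for \<open>SO\<^sub>m\<close> as a predicate; its uniqueness is
  not presupposed. Integrability is required explicitly because the Bochner integral of a
  non-integrable function is \<open>0\<close>.
\<close>

definition is_hilbert_measure ::
    "'m::finite itself \<Rightarrow> (real^('k::finite uprod)) measure \<Rightarrow> bool" where
  "is_hilbert_measure T M \<longleftrightarrow>
     (\<exists>l :: real^('k::finite uprod) \<Rightarrow> real.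
        l \<in> borel_measurable lborel \<and> (\<forall>u. 0 \<le> l u) \<and> M = density_on_image T l \<and>
        (\<forall>(f :: real^'m::finite^'k::finite \<Rightarrow> real) (F :: real^('k::finite uprod) \<Rightarrow> real).
           smooth_compact_support f \<and> SO_invariant f \<and>
           smooth_compact_support F \<and> (\<forall>v. f v = F (hilbert_map v)) \<longrightarrow>
           set_integrable lborel (hilbert_image T) (\<lambda>u. F u * l u) \<and>
           (LINT v|lborel. f v) = (LINT u:hilbert_image T|lborel. F u * l u)))"

text \<open>\<open>sphere_vol d\<close> is the volume of the unit sphere \<open>S\<^sup>d\<close> in \<open>\<real>\<^sup>d\<^sup>+\<^sup>1\<close>.\<close>

definition sphere_vol :: "nat \<Rightarrow> real" where
  "sphere_vol d = 2 * pi powr ((real d + 1) / 2) / Gamma ((real d + 1) / 2)"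

lemma sphere_vol_unit_ball_vol: "sphere_vol d = (real d + 1) * unit_ball_vol (real d + 1)"
proof -
  have "Gamma ((real d + 1) / 2 + 1) = (real d + 1) / 2 * Gamma ((real d + 1) / 2)"
    by (rule Gamma_plus1) (auto simp: nonpos_Ints_def)
  thus ?thesis
    unfolding sphere_vol_def unit_ball_vol_def by (simp only:) (simp add: divide_simps)
qed

definition orthogonal_group_vol :: "nat \<Rightarrow> real" where
  "orthogonal_group_vol n =
     2 ^ n * sqrt pi ^ (Suc n choose 2) / (\<Prod>j=1..n. Gamma (real j / 2))"

text \<open>\<open>stiefel_vol m k\<close> is the volume of \<open>O\<^sub>m / O\<^sub>m\<^sub>-\<^sub>k\<close>, for \<open>k \<le> m\<close>.\<close>

definition stiefel_vol :: "nat \<Rightarrow> nat \<Rightarrow> real" where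
  "stiefel_vol m k = orthogonal_group_vol m / orthogonal_group_vol (m - k)"

text \<open>
  \<open>gram_power T u\<close> is \<open>|G\<^sub>k|\<close> to the power \<open>(m - k - 1) / 2\<close>, used for \<open>k \<le> m - 1\<close>, where the
  subtraction on \<^typ>\<open>nat\<close> is exact. A power of the square root is used rather than
  \<open>powr\<close>, for which \<open>0 powr 0 = 0\<close>.
\<close>

definition gram_power :: "'m::finite itself \<Rightarrow> real^('k::finite uprod) \<Rightarrow> real" where
  "gram_power (_ :: 'm::finite itself) (u :: real^('k::finite uprod)) =
     sqrt (det (gram_matrix u)) ^ (CARD('m) - CARD('k) - 1)"

end

theory Submission
  imports Defs
begin

text \<open>
  The Hilbert measure is the push-forward of Lebesgue measure under the Gram map, computed by
  induction on the number of vectors. Fix the vector \<open>x = v\<^sub>a\<close>, put \<open>s = x \<bullet> x\<close>,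
  \<open>e = x / \<bar>x\<bar>\<close>, and write the others as \<open>v\<^sub>i = t\<^sub>i e + y\<^sub>i\<close> with \<open>y\<^sub>i\<close> orthogonal to \<open>e\<close>. The new
  Gram entries are \<open>s\<close>, \<open>w\<^sub>i = \<surd>s t\<^sub>i\<close> and \<open>t\<^sub>i t\<^sub>j + y\<^sub>i \<bullet> y\<^sub>j\<close>, so the Gram matrix of the \<open>y\<^sub>i\<close> is the
  Schur complement of \<open>s\<close> and the induction hypothesis applies to it in one dimension less. The
  exponent \<open>m - k - 1\<close> is the same at each step; the powers of \<open>s\<close> produced by rescaling \<open>t\<close> and by
  the determinant cancel against the radial density of \<open>x\<close>, which contributes half the volume of a
  sphere. Uniqueness holds because the indicator of a box is an increasing limit of smooth functions
  \<open>1 - (1 - g)\<^sup>n\<close>, and the Gram map is proper.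
\<close>

subsection \<open>Finite products of Lebesgue measure\<close>

text \<open>Two obstacles shape the argument. The complement of \<open>x\<close> depends on
  \<open>x\<close> and loses a dimension at each step, while the dimension of a type is fixed.
  Lebesgue measure on a subspace is therefore a measure on the ambient type, given by coordinates in
  an orthonormal set; its independence of that set replaces a rotation of \<open>x\<close> onto an
  axis. Moreover, the recursion yields the density on the region where successive pivots are
  positive, not on the image of the Hilbert map. The region stays an abstract predicate
  \<open>D\<close> and is exchanged for the image only at the end, up to a null set: it contains
  every nonsingular Gram matrix, and the push-forward does not charge the complement of the image.
  The constant arises as follows: with \<open>p = m - k - 1\<close>, the step that leaves
  \<open>i\<close> vectors takes place in dimension \<open>p + i + 2\<close> and contributes half
  the volume of the sphere of dimension \<open>p + i + 1\<close>.\<close>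

lemma product_sigma_finite_const: "sigma_finite_measure M \<Longrightarrow> product_sigma_finite (\<lambda>_. M)"
  by (simp add: product_sigma_finite_def)

lemma product_sigma_finite_lborel: "product_sigma_finite (\<lambda>_. lborel)"
  by (simp add: product_sigma_finite_def lborel.sigma_finite_measure_axioms)

text \<open>The one-variable affine substitution, applied to one coordinate after another. It serves
  both as a translation (\<open>r = 1\<close>) and as a scaling (\<open>c = 0\<close>).\<close>

lemma nn_integral_PiM_lborel_affine:
  fixes c :: "'i \<Rightarrow> real"
  assumes "finite K" "r > 0" and f: "f \<in> borel_measurable (PiM K (\<lambda>_. lborel))"
  shows "(\<integral>\<^sup>+x. f x \<partial>PiM K (\<lambda>_. lborel)) =
    ennreal (r ^ card K) * (\<integral>\<^sup>+x. f (\<lambda>i\<in>K. c i + r * x i) \<partial>PiM K (\<lambda>_. lborel))"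
  using \<open>finite K\<close> f
proof (induction K arbitrary: f)
  case empty
  then show ?case
    by (simp add: PiM_empty nn_integral_count_space_finite restrict_def)
next
  case (insert i K)
  interpret product_sigma_finite "\<lambda>_::'i. lborel :: real measure"
    by (rule product_sigma_finite_lborel)
  note [measurable] = insert.prems
  have upd: "(\<lambda>p. f ((\<lambda>i\<in>K. c i + r * snd p i)(i := fst p)))
      \<in> borel_measurable (lborel \<Otimes>\<^sub>M PiM K (\<lambda>_. lborel))"
    by (rule measurable_compose[OF measurable_fun_upd[where J = K] insert.prems]) (simp, measurable)
  interpret sigma_finite_measure "PiM K (\<lambda>_::'i. lborel :: real measure)"
    by (rule sigma_finite) fact
  have [measurable]: "(\<lambda>y. \<integral>\<^sup>+x. f ((\<lambda>i\<in>K. c i + r * x i)(i := y)) \<partial>PiM K (\<lambda>_. lborel)) \<in> borel_measurable lborel"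
    using borel_measurable_nn_integral_fst[OF upd] by simp
  have "(\<integral>\<^sup>+x. f x \<partial>PiM (insert i K) (\<lambda>_. lborel)) =
      (\<integral>\<^sup>+y. \<integral>\<^sup>+x. f (x(i := y)) \<partial>PiM K (\<lambda>_. lborel) \<partial>lborel)"
    using insert by (intro product_nn_integral_insert_rev) auto
  also have "\<dots> = (\<integral>\<^sup>+y. ennreal (r ^ card K) *
       (\<integral>\<^sup>+x. f ((\<lambda>i\<in>K. c i + r * x i)(i := y)) \<partial>PiM K (\<lambda>_. lborel)) \<partial>lborel)"
    by (intro nn_integral_cong insert.IH) measurable
  also have "\<dots> = ennreal (r ^ card K) *
       (\<integral>\<^sup>+y. \<integral>\<^sup>+x. f ((\<lambda>i\<in>K. c i + r * x i)(i := y)) \<partial>PiM K (\<lambda>_. lborel) \<partial>lborel)"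
    by (intro nn_integral_cmult) measurable
  also have "(\<integral>\<^sup>+y. \<integral>\<^sup>+x. f ((\<lambda>i\<in>K. c i + r * x i)(i := y)) \<partial>PiM K (\<lambda>_. lborel) \<partial>lborel) =
     ennreal r * (\<integral>\<^sup>+y. \<integral>\<^sup>+x. f ((\<lambda>i\<in>K. c i + r * x i)(i := c i + r * y)) \<partial>PiM K (\<lambda>_. lborel) \<partial>lborel)"
  proof -
    show ?thesis
      using \<open>r > 0\<close> by (subst nn_integral_real_affine[where c = r and t = "c i"]) auto
  qed
  also have "(\<integral>\<^sup>+y. \<integral>\<^sup>+x. f ((\<lambda>i\<in>K. c i + r * x i)(i := c i + r * y)) \<partial>PiM K (\<lambda>_. lborel) \<partial>lborel) =
    (\<integral>\<^sup>+y. \<integral>\<^sup>+x. f (\<lambda>j\<in>insert i K. c j + r * (x(i := y)) j) \<partial>PiM K (\<lambda>_. lborel) \<partial>lborel)"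
    by (intro nn_integral_cong arg_cong[where f = f]) (use insert.hyps in \<open>auto simp: fun_eq_iff\<close>)
  also have "\<dots> = (\<integral>\<^sup>+x. f (\<lambda>j\<in>insert i K. c j + r * x j) \<partial>PiM (insert i K) (\<lambda>_. lborel))"
    using insert by (subst product_nn_integral_insert_rev) auto
  moreover have "ennreal (r ^ card (insert i K)) = ennreal (r ^ card K) * ennreal r"
    using insert.hyps \<open>r > 0\<close> by (simp add: ennreal_mult mult_ac)
  ultimately show ?case
    by (simp only: mult.assoc)
qed

text \<open>Rectangles determine a product measure, and relabelling the coordinates only permutes
  the factors of a rectangle's volume. The border entries \<open>Upair a i\<close> are later
  relabelled by \<open>i\<close> in this way.\<close>

lemma nn_integral_PiM_reindex:
  fixes M :: "'a measure"
  assumes M: "sigma_finite_measure M" and "finite I" "inj_on g I"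
    and [measurable]: "f \<in> borel_measurable (PiM I (\<lambda>_. M))"
  shows "(\<integral>\<^sup>+x. f x \<partial>PiM I (\<lambda>_. M)) = (\<integral>\<^sup>+x. f (\<lambda>i\<in>I. x (g i)) \<partial>PiM (g ` I) (\<lambda>_. M))"
proof -
  interpret I: product_sigma_finite "\<lambda>_::'b. M" by (rule product_sigma_finite_const[OF M])
  interpret J: product_sigma_finite "\<lambda>_::'c. M" by (rule product_sigma_finite_const[OF M])
  have m[measurable]: "(\<lambda>x. \<lambda>i\<in>I. x (g i)) \<in> PiM (g ` I) (\<lambda>_. M) \<rightarrow>\<^sub>M PiM I (\<lambda>_. M)"
    by measurable
  have "distr (PiM (g ` I) (\<lambda>_. M)) (PiM I (\<lambda>_. M)) (\<lambda>x. \<lambda>i\<in>I. x (g i)) = PiM I (\<lambda>_. M)"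
  proof (rule I.PiM_eqI)
    fix A assume A: "\<And>i. i \<in> I \<Longrightarrow> A i \<in> sets M"
    define A' where "A' = (\<lambda>j. A (the_inv_into I g j))"
    have A': "A' (g i) = A i" if "i \<in> I" for i
      using that assms by (simp add: A'_def the_inv_into_f_f)
    have "(\<lambda>x. \<lambda>i\<in>I. x (g i)) -` (Pi\<^sub>E I A) \<inter> space (PiM (g ` I) (\<lambda>_. M)) = Pi\<^sub>E (g ` I) A'"
      using A sets.sets_into_space
      by (fastforce simp: space_PiM PiE_iff A' extensional_def)
    then have "emeasure (distr (PiM (g ` I) (\<lambda>_. M)) (PiM I (\<lambda>_. M)) (\<lambda>x. \<lambda>i\<in>I. x (g i))) (Pi\<^sub>E I A) =
       emeasure (PiM (g ` I) (\<lambda>_. M)) (Pi\<^sub>E (g ` I) A')"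
      using assms A by (subst emeasure_distr) (auto intro!: sets_PiM_I_finite)
    also have "\<dots> = (\<Prod>j\<in>g ` I. emeasure M (A' j))"
      using assms A A' by (intro J.emeasure_PiM) auto
    also have "\<dots> = (\<Prod>i\<in>I. emeasure M (A i))"
      using assms A' by (simp add: prod.reindex)
    finally show "emeasure (distr (PiM (g ` I) (\<lambda>_. M)) (PiM I (\<lambda>_. M)) (\<lambda>x. \<lambda>i\<in>I. x (g i))) (Pi\<^sub>E I A) =
       (\<Prod>i\<in>I. emeasure M (A i))" .
  qed (use assms in auto)
  then have "(\<integral>\<^sup>+x. f x \<partial>PiM I (\<lambda>_. M)) =
     (\<integral>\<^sup>+x. f x \<partial>distr (PiM (g ` I) (\<lambda>_. M)) (PiM I (\<lambda>_. M)) (\<lambda>x. \<lambda>i\<in>I. x (g i)))"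
    by simp
  also have "\<dots> = (\<integral>\<^sup>+x. f (\<lambda>i\<in>I. x (g i)) \<partial>PiM (g ` I) (\<lambda>_. M))"
    by (rule nn_integral_distr) measurable
  finally show ?thesis .
qed

text \<open>A product of image measures is the image of the two products. With \<open>L\<close> a
  line and \<open>N\<close> its orthogonal complement, this separates the components of all vectors
  along the line from the orthogonal ones.\<close>

lemma nn_integral_PiM_distr_pair:
  fixes h :: "'a \<times> 'b \<Rightarrow> 'c"
  assumes L: "sigma_finite_measure L" and N: "sigma_finite_measure N"
    and M: "sigma_finite_measure M" "M = distr (L \<Otimes>\<^sub>M N) R h"
    and h[measurable]: "h \<in> L \<Otimes>\<^sub>M N \<rightarrow>\<^sub>M R"
    and "finite I" and f: "f \<in> borel_measurable (PiM I (\<lambda>_. R))"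
  shows "(\<integral>\<^sup>+v. f v \<partial>PiM I (\<lambda>_. M)) =
    (\<integral>\<^sup>+t. \<integral>\<^sup>+y. f (\<lambda>i\<in>I. h (t i, y i)) \<partial>PiM I (\<lambda>_. N) \<partial>PiM I (\<lambda>_. L))"
  using \<open>finite I\<close> f
proof (induction I arbitrary: f)
  case empty
  then show ?case by (simp add: PiM_empty nn_integral_count_space_finite restrict_def)
next
  case (insert i I)
  interpret L: product_sigma_finite "\<lambda>_::'d. L" by (rule product_sigma_finite_const[OF L])
  interpret N: product_sigma_finite "\<lambda>_::'d. N" by (rule product_sigma_finite_const[OF N])
  interpret M: product_sigma_finite "\<lambda>_::'d. M" by (rule product_sigma_finite_const[OF M(1)])
  interpret LN: pair_sigma_finite L N by (intro pair_sigma_finite.intro L N)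
  interpret NI: sigma_finite_measure "PiM I (\<lambda>_. N)" by (rule N.sigma_finite[OF insert.hyps(1)])
  interpret PLN: pair_sigma_finite L "PiM I (\<lambda>_. N)"
    by (intro pair_sigma_finite.intro L NI.sigma_finite_measure_axioms)
  interpret NIN: pair_sigma_finite "PiM I (\<lambda>_. N)" N
    by (intro pair_sigma_finite.intro N NI.sigma_finite_measure_axioms)
  note [measurable] = insert.prems
  have sM: "sets M = sets R" by (simp add: M)
  note [measurable_cong] = sM
  interpret Ms: sigma_finite_measure M by fact
  have "(\<integral>\<^sup>+v. f v \<partial>PiM (insert i I) (\<lambda>_. M)) =
      (\<integral>\<^sup>+v. \<integral>\<^sup>+x. f (v(i := x)) \<partial>M \<partial>PiM I (\<lambda>_. M))"
    using insert by (intro M.product_nn_integral_insert) auto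
  also have "\<dots> = (\<integral>\<^sup>+t. \<integral>\<^sup>+y. (\<integral>\<^sup>+x. f ((\<lambda>i\<in>I. h (t i, y i))(i := x)) \<partial>M) \<partial>PiM I (\<lambda>_. N) \<partial>PiM I (\<lambda>_. L))"
    by (intro insert.IH) measurable
  also have "\<dots> = (\<integral>\<^sup>+t. \<integral>\<^sup>+y. (\<integral>\<^sup>+r. \<integral>\<^sup>+z. f ((\<lambda>i\<in>I. h (t i, y i))(i := h (r, z))) \<partial>N \<partial>L)
       \<partial>PiM I (\<lambda>_. N) \<partial>PiM I (\<lambda>_. L))"
  proof (intro nn_integral_cong)
    fix t y assume ty[simp]: "t \<in> space (PiM I (\<lambda>_. L))" "y \<in> space (PiM I (\<lambda>_. N))"
    have hI: "(\<lambda>i\<in>I. h (t i, y i)) \<in> space (PiM I (\<lambda>_. R))"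
      using ty unfolding space_PiM by (auto simp: space_pair_measure PiE_iff intro!: measurable_space[OF h])
    have [measurable]: "(\<lambda>x. f ((\<lambda>i\<in>I. h (t i, y i))(i := x))) \<in> borel_measurable R"
      using insert.hyps by (intro measurable_compose[OF measurable_component_update[OF hI] insert.prems])
    show "(\<integral>\<^sup>+x. f ((\<lambda>i\<in>I. h (t i, y i))(i := x)) \<partial>M) =
       (\<integral>\<^sup>+r. \<integral>\<^sup>+z. f ((\<lambda>i\<in>I. h (t i, y i))(i := h (r, z))) \<partial>N \<partial>L)"
      unfolding M by (simp add: nn_integral_distr sigma_finite_measure.nn_integral_fst[OF N, symmetric])
  qed
  \<comment> \<open>The new \<open>L\<close>-coordinate \<open>r\<close> has to precede the old
    \<open>N\<close>-coordinates \<open>y\<close>, so that \<open>t, r\<close> and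
    \<open>y, z\<close> can be merged into points over \<open>insert i I\<close>.\<close>
  also have "\<dots> = (\<integral>\<^sup>+t. \<integral>\<^sup>+r. \<integral>\<^sup>+y. \<integral>\<^sup>+z. f ((\<lambda>i\<in>I. h (t i, y i))(i := h (r, z))) \<partial>N
       \<partial>PiM I (\<lambda>_. N) \<partial>L \<partial>PiM I (\<lambda>_. L))"
  proof (intro nn_integral_cong)
    fix t assume t: "t \<in> space (PiM I (\<lambda>_. L))"
    have [measurable]: "t i \<in> space L" if "i \<in> I" for i
      using t that by (auto simp: space_PiM)
    show "(\<integral>\<^sup>+y. (\<integral>\<^sup>+r. \<integral>\<^sup>+z. f ((\<lambda>i\<in>I. h (t i, y i))(i := h (r, z))) \<partial>N \<partial>L) \<partial>PiM I (\<lambda>_. N)) =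
      (\<integral>\<^sup>+r. \<integral>\<^sup>+y. \<integral>\<^sup>+z. f ((\<lambda>i\<in>I. h (t i, y i))(i := h (r, z))) \<partial>N \<partial>PiM I (\<lambda>_. N) \<partial>L)"
      by (rule PLN.Fubini') measurable
  qed
  also have "\<dots> = (\<integral>\<^sup>+t. \<integral>\<^sup>+r. \<integral>\<^sup>+y. \<integral>\<^sup>+z. f (\<lambda>j\<in>insert i I. h ((t(i := r)) j, (y(i := z)) j)) \<partial>N
       \<partial>PiM I (\<lambda>_. N) \<partial>L \<partial>PiM I (\<lambda>_. L))"
    by (intro nn_integral_cong arg_cong[where f = f]) (use insert.hyps in \<open>auto simp: fun_eq_iff\<close>)
  also have "\<dots> = (\<integral>\<^sup>+t. \<integral>\<^sup>+r. \<integral>\<^sup>+y. f (\<lambda>j\<in>insert i I. h ((t(i := r)) j, y j))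
       \<partial>PiM (insert i I) (\<lambda>_. N) \<partial>L \<partial>PiM I (\<lambda>_. L))"
  proof (intro nn_integral_cong)
    fix t r assume t[simp]: "t \<in> space (PiM I (\<lambda>_. L))" "r \<in> space L"
    have [measurable]: "(t(i := r)) j \<in> space L" if "j \<in> insert i I" for j
      using t that by (auto simp: space_PiM)
    show "(\<integral>\<^sup>+y. \<integral>\<^sup>+z. f (\<lambda>j\<in>insert i I. h ((t(i := r)) j, (y(i := z)) j)) \<partial>N \<partial>PiM I (\<lambda>_. N)) =
      (\<integral>\<^sup>+y. f (\<lambda>j\<in>insert i I. h ((t(i := r)) j, y j)) \<partial>PiM (insert i I) (\<lambda>_. N))"
    proof (intro N.product_nn_integral_insert[symmetric] insert.hyps)
      show "(\<lambda>y. f (\<lambda>j\<in>insert i I. h ((t(i := r)) j, y j))) \<in> borel_measurable (PiM (insert i I) (\<lambda>_. N))"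
        by measurable
    qed
  qed
  also have "\<dots> = (\<integral>\<^sup>+t. \<integral>\<^sup>+y. f (\<lambda>j\<in>insert i I. h (t j, y j))
       \<partial>PiM (insert i I) (\<lambda>_. N) \<partial>PiM (insert i I) (\<lambda>_. L))"
  proof (subst L.product_nn_integral_insert)
    interpret NII: sigma_finite_measure "PiM (insert i I) (\<lambda>_. N)"
      using N.sigma_finite[of "insert i I"] insert.hyps by simp
    show "(\<lambda>t. \<integral>\<^sup>+y. f (\<lambda>j\<in>insert i I. h (t j, y j)) \<partial>PiM (insert i I) (\<lambda>_. N))
        \<in> borel_measurable (PiM (insert i I) (\<lambda>_. L))"
      by measurable
  qed (use insert.hyps in auto)
  finally show ?case .
qed

subsection \<open>Lebesgue measure on a subspace\<close>

definition orthonormal :: "'a::real_inner set \<Rightarrow> bool" where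
  "orthonormal B \<longleftrightarrow> finite B \<and> (\<forall>b\<in>B. \<forall>c\<in>B. b \<bullet> c = (if b = c then 1 else 0))"

text \<open>For orthonormal \<open>B\<close> this is Lebesgue measure on \<open>span B\<close>,
  carried by the ambient type so that the dimension can vary within an induction. The basis vectors
  themselves index the coordinates.\<close>

definition span_lborel :: "'a::euclidean_space set \<Rightarrow> 'a measure" where
  "span_lborel B = distr (PiM B (\<lambda>_. lborel)) borel (\<lambda>f. \<Sum>b\<in>B. f b *\<^sub>R b)"

lemma span_lborel_Basis: "span_lborel Basis = lborel"
  by (simp add: span_lborel_def flip: lborel_eq)

lemma orthonormal_Basis: "orthonormal Basis"
  by (simp add: orthonormal_def inner_Basis)

lemma sets_span_lborel [simp, measurable_cong]: "sets (span_lborel B) = sets borel"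
  by (simp add: span_lborel_def)

lemma space_span_lborel [simp]: "space (span_lborel B) = UNIV"
  by (simp add: span_lborel_def)

lemma measurable_coordinates_sum [measurable]:
  "(\<lambda>f. \<Sum>b\<in>B. f b *\<^sub>R b) \<in> PiM B (\<lambda>_. lborel) \<rightarrow>\<^sub>M (borel :: 'a::euclidean_space measure)"
  by (rule borel_measurable_sum) measurable

lemma nn_integral_span_lborel:
  "f \<in> borel_measurable borel \<Longrightarrow>
    (\<integral>\<^sup>+x. f x \<partial>span_lborel B) = (\<integral>\<^sup>+f'. f (\<Sum>b\<in>B. f' b *\<^sub>R b) \<partial>PiM B (\<lambda>_. lborel))"
  unfolding span_lborel_def by (rule nn_integral_distr) measurable

text \<open>The measure lives on the whole type, so properties of vectors in the subspace, such as
  orthogonality to \<open>e\<close>, enter later arguments only almost everywhere.\<close>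

lemma AE_span_lborel: "AE x in span_lborel B. x \<in> span B"
proof -
  have "closed (span B)" by (rule closed_subspace) (rule subspace_span)
  then have "{x \<in> space borel. x \<in> span B} \<in> sets borel" by simp
  then show ?thesis unfolding span_lborel_def
    by (subst AE_distr_iff) (auto intro!: AE_I2 span_sum[of B] span_scale intro: span_base)
qed

lemma orthonormal_inner_sum:
  assumes B: "orthonormal B"
  shows "(\<Sum>b\<in>B. u b *\<^sub>R b) \<bullet> (\<Sum>b\<in>B. u b *\<^sub>R b) = (\<Sum>b\<in>B. (u b)\<^sup>2)"
proof -
  have "finite B" using B by (simp add: orthonormal_def)
  have "(\<Sum>b\<in>B. u b *\<^sub>R b) \<bullet> (\<Sum>b\<in>B. u b *\<^sub>R b) = (\<Sum>b\<in>B. \<Sum>c\<in>B. u b * u c * (b \<bullet> c))"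
    by (simp add: inner_sum_left inner_sum_right sum_distrib_left mult_ac inner_commute)
  also have "\<dots> = (\<Sum>b\<in>B. \<Sum>c\<in>B. if c = b then u b * u c else 0)"
    using B by (intro sum.cong) (auto simp: orthonormal_def)
  also have "\<dots> = (\<Sum>b\<in>B. (u b)\<^sup>2)"
    using \<open>finite B\<close> by (simp add: power2_eq_square)
  finally show ?thesis .
qed

lemma nn_integral_span_lborel_shift:
  assumes "finite B" "y \<in> span B" and f[measurable]: "f \<in> borel_measurable borel"
  shows "(\<integral>\<^sup>+x. f (x + y) \<partial>span_lborel B) = (\<integral>\<^sup>+x. f x \<partial>span_lborel B)"
proof -
  obtain u where y: "y = (\<Sum>b\<in>B. u b *\<^sub>R b)"
    using assms by (auto simp: span_finite)
  have "(\<integral>\<^sup>+x. f x \<partial>span_lborel B) = (\<integral>\<^sup>+z. f (\<Sum>b\<in>B. z b *\<^sub>R b) \<partial>PiM B (\<lambda>_. lborel))"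
    by (rule nn_integral_span_lborel) measurable
  also have "\<dots> = (\<integral>\<^sup>+z. f (\<Sum>b\<in>B. (\<lambda>b\<in>B. u b + 1 * z b) b *\<^sub>R b) \<partial>PiM B (\<lambda>_. lborel))"
    by (subst nn_integral_PiM_lborel_affine[OF \<open>finite B\<close>, where r = 1 and c = u]) (simp_all, measurable)
  also have "\<dots> = (\<integral>\<^sup>+z. f ((\<Sum>b\<in>B. z b *\<^sub>R b) + y) \<partial>PiM B (\<lambda>_. lborel))"
    by (simp add: y scaleR_add_left sum.distrib add.commute)
  also have "\<dots> = (\<integral>\<^sup>+x. f (x + y) \<partial>span_lborel B)"
    by (subst nn_integral_span_lborel) measurable
  finally show ?thesis by simp
qed

text \<open>Orthonormality turns the set into a Euclidean ball in coordinate space. Here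
  \<open>r\<close> is a squared radius, which suits the Gram coordinate
  \<open>s = x \<bullet> x\<close>.\<close>

lemma emeasure_span_lborel_ball:
  assumes B: "orthonormal B" and "r > 0"
  shows "emeasure (span_lborel B) {x. x \<bullet> x \<le> r} = ennreal (unit_ball_vol (card B) * sqrt r ^ card B)"
proof -
  have [measurable]: "{x::'a. x \<bullet> x \<le> r} \<in> sets borel" by measurable
  have "finite B" using B by (simp add: orthonormal_def)
  have "(\<lambda>f. \<Sum>b\<in>B. f b *\<^sub>R b) -` {x. x \<bullet> x \<le> r} \<inter> space (PiM B (\<lambda>_. lborel)) =
     {f. sqrt (\<Sum>i\<in>B. (f i)\<^sup>2) \<le> sqrt r} \<inter> space (PiM B (\<lambda>_. lborel))"
    using orthonormal_inner_sum[OF B] by auto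
  then show ?thesis
    using emeasure_cball_aux[OF \<open>finite B\<close>, of "sqrt r"] \<open>r > 0\<close>
    by (simp add: span_lborel_def emeasure_distr)
qed

lemma sigma_finite_span_lborel:
  assumes B: "orthonormal B"
  shows "sigma_finite_measure (span_lborel B)"
proof
  have "\<exists>n::nat. x \<bullet> x \<le> real (Suc n)" for x :: 'a
  proof -
    obtain n :: nat where "x \<bullet> x \<le> real n" using real_arch_simple by blast
    then have "x \<bullet> x \<le> real (Suc n)" by simp
    then show ?thesis by blast
  qed
  then show "\<exists>A. countable A \<and> A \<subseteq> sets (span_lborel B) \<and> \<Union> A = space (span_lborel B) \<and>
      (\<forall>a\<in>A. emeasure (span_lborel B) a \<noteq> \<infinity>)"
    by (intro exI[of _ "range (\<lambda>n::nat. {x. x \<bullet> x \<le> real (Suc n)})"])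
       (auto simp del: of_nat_Suc simp: emeasure_span_lborel_ball[OF B])
qed

text \<open>
  Two \<open>\<sigma>\<close>-finite measures on the same subspace that are invariant under its translations are
  proportional: by Tonelli \<open>\<integral>f d\<mu> \<integral>g d\<nu> = \<integral>f d\<nu> \<integral>g d\<mu>\<close> for even \<open>g\<close>. The indicator of the unit
  ball as \<open>g\<close> fixes the constant.
\<close>

lemma span_lborel_cong:
  assumes B: "orthonormal B" and C: "orthonormal C" and span: "span B = span C" and card: "card B = card C"
  shows "span_lborel B = span_lborel C"
proof -
  have fin: "finite B" "finite C" using B C by (auto simp: orthonormal_def)
  interpret B: sigma_finite_measure "span_lborel B" by (rule sigma_finite_span_lborel[OF B])
  interpret C: sigma_finite_measure "span_lborel C" by (rule sigma_finite_span_lborel[OF C])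
  interpret BC: pair_sigma_finite "span_lborel B" "span_lborel C" by unfold_locales
  define g :: "'a \<Rightarrow> ennreal" where "g = indicator {x. x \<bullet> x \<le> 1}"
  have [measurable]: "g \<in> borel_measurable borel" unfolding g_def by measurable
  have g_even: "g (x - y) = g (y - x)" for x y
    by (simp add: g_def indicator_def algebra_simps inner_commute)
  have main: "(\<integral>\<^sup>+x. f x \<partial>span_lborel B) * (\<integral>\<^sup>+y. g y \<partial>span_lborel C) =
    (\<integral>\<^sup>+x. f x \<partial>span_lborel C) * (\<integral>\<^sup>+y. g y \<partial>span_lborel B)"
    if [measurable]: "f \<in> borel_measurable borel" for f :: "'a \<Rightarrow> ennreal"
  proof -
    have "(\<integral>\<^sup>+x. f x \<partial>span_lborel B) * (\<integral>\<^sup>+y. g y \<partial>span_lborel C) =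
       (\<integral>\<^sup>+y. (\<integral>\<^sup>+x. f x \<partial>span_lborel B) * g y \<partial>span_lborel C)"
      by (simp add: nn_integral_cmult)
    \<comment> \<open>Almost every \<open>y\<close> lies in \<open>span C = span B\<close>, so
      translation by it preserves \<open>span_lborel B\<close>.\<close>
    also have "\<dots> = (\<integral>\<^sup>+y. (\<integral>\<^sup>+x. f (x + y) * g y \<partial>span_lborel B) \<partial>span_lborel C)"
      using AE_span_lborel[of C]
      by (intro nn_integral_cong_AE) (auto simp: nn_integral_multc nn_integral_span_lborel_shift fin span)
    also have "\<dots> = (\<integral>\<^sup>+x. (\<integral>\<^sup>+y. f (x + y) * g y \<partial>span_lborel C) \<partial>span_lborel B)"
      by (rule BC.Fubini') measurable
    \<comment> \<open>Replacing \<open>y\<close> by \<open>y - x\<close> moves the shift from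
      \<open>f\<close> to \<open>g\<close>; since \<open>g\<close> is even, \<open>x\<close> can
      then be integrated out by a translation.\<close>
    also have "\<dots> = (\<integral>\<^sup>+x. (\<integral>\<^sup>+y. f y * g (y - x) \<partial>span_lborel C) \<partial>span_lborel B)"
    proof (rule nn_integral_cong_AE, use AE_span_lborel[of B] in eventually_elim)
      case (elim x)
      then show ?case
        using nn_integral_span_lborel_shift[of C x "\<lambda>y. f y * g (y - x)"] fin
        by (simp add: span add.commute)
    qed
    also have "\<dots> = (\<integral>\<^sup>+y. (\<integral>\<^sup>+x. f y * g (y - x) \<partial>span_lborel B) \<partial>span_lborel C)"
      by (rule BC.Fubini'[symmetric]) measurable
    also have "\<dots> = (\<integral>\<^sup>+y. f y * (\<integral>\<^sup>+x. g x \<partial>span_lborel B) \<partial>span_lborel C)"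
    proof (rule nn_integral_cong_AE, use AE_span_lborel[of C] in eventually_elim)
      case (elim y)
      have "(\<integral>\<^sup>+x. f y * g (y - x) \<partial>span_lborel B) = f y * (\<integral>\<^sup>+x. g (x + - y) \<partial>span_lborel B)"
        by (simp add: nn_integral_cmult g_even[of y])
      also have "(\<integral>\<^sup>+x. g (x + - y) \<partial>span_lborel B) = (\<integral>\<^sup>+x. g x \<partial>span_lborel B)"
        using elim span_neg[of y B] by (intro nn_integral_span_lborel_shift) (auto simp: fin span)
      finally show ?case .
    qed
    also have "\<dots> = (\<integral>\<^sup>+x. f x \<partial>span_lborel C) * (\<integral>\<^sup>+y. g y \<partial>span_lborel B)"
      by (simp add: nn_integral_multc)
    finally show ?thesis .
  qed
  have g: "(\<integral>\<^sup>+y. g y \<partial>span_lborel B) = ennreal (unit_ball_vol (card C))"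
    "(\<integral>\<^sup>+y. g y \<partial>span_lborel C) = ennreal (unit_ball_vol (card C))"
    using emeasure_span_lborel_ball[OF B, of 1] emeasure_span_lborel_ball[OF C, of 1] card
    by (simp_all add: g_def)
  show ?thesis
  proof (rule measure_eqI)
    fix A :: "'a set" assume A: "A \<in> sets (span_lborel B)"
    have "emeasure (span_lborel B) A * ennreal (unit_ball_vol (card C)) =
       emeasure (span_lborel C) A * ennreal (unit_ball_vol (card C))"
      using main[of "indicator A"] A by (simp add: g)
    \<comment> \<open>Being finite and nonzero, the common volume of the unit ball can be cancelled
      in \<open>ennreal\<close>.\<close>
    moreover have "ennreal (unit_ball_vol (card C)) \<noteq> 0"
      using unit_ball_vol_pos[of "real (card C)"] by (metis ennreal_less_zero_iff less_irrefl of_nat_0_le_iff)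
    ultimately show "emeasure (span_lborel B) A = emeasure (span_lborel C) A"
      by (metis ennreal_mult_cancel_left ennreal_neq_top infinity_ennreal_def mult.commute)
  qed simp
qed

section \<open>Splitting off a unit vector, and the law of the squared length\<close>

text \<open>\<open>C\<close> is an orthonormal basis of the part of \<open>span B\<close> orthogonal
  to \<open>e\<close>. The basis is adapted to \<open>e\<close> instead of \<open>e\<close> being
  rotated; \<open>span_lborel_cong\<close> absorbs the change of basis.\<close>

lemma orthonormal_insert_unit:
  fixes B :: "'a::euclidean_space set"
  assumes B: "orthonormal B" and e: "e \<in> span B" "e \<bullet> e = 1"
  obtains C where "orthonormal C" "e \<notin> C" "\<And>x. x \<in> span C \<Longrightarrow> x \<bullet> e = 0" "Suc (card C) = card B"
    "span_lborel B = span_lborel (insert e C)"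
proof -
  have ind: "independent B" if "orthonormal B" for B :: "'a set"
  proof (rule pairwise_orthogonal_independent)
    show "pairwise orthogonal B" "0 \<notin> B"
      using that by (auto simp: pairwise_def orthogonal_def orthonormal_def)
        (metis inner_zero_left zero_neq_one)
  qed
  define S where "S = {x \<in> span B. x \<bullet> e = 0}"
  have "subspace S"
    using subspace_span[of B] by (auto simp: S_def subspace_def inner_add_left)
  then obtain C where C: "C \<subseteq> S" "pairwise orthogonal C" "\<And>x. x \<in> C \<Longrightarrow> norm x = 1"
    "independent C" "card C = dim S" "span C = S"
    by (rule orthonormal_basis_subspace) blast
  have C0: "x \<bullet> e = 0" if "x \<in> span C" for x using that C by (auto simp: S_def)
  have "finite C" using C independent_imp_finite by blast
  have oC: "orthonormal C"
    using C(2,3) \<open>finite C\<close> by (auto simp: orthonormal_def pairwise_def orthogonal_def norm_eq_1)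
  have eC: "e \<notin> C" using e C0[of e] span_base by force
  have oI: "orthonormal (insert e C)"
    using oC C0 span_base e eC by (auto simp: orthonormal_def inner_commute)
  have sp: "span (insert e C) = span B"
  proof
    show "span (insert e C) \<subseteq> span B"
      by (rule span_minimal) (use C e in \<open>auto simp: S_def\<close>)
    show "span B \<subseteq> span (insert e C)"
    proof
      fix x assume "x \<in> span B"
      then have "x - (x \<bullet> e) *\<^sub>R e \<in> span C"
        using e C by (auto simp: S_def algebra_simps intro!: span_diff span_scale)
      then show "x \<in> span (insert e C)"
        by (auto simp: span_insert)
    qed
  qed
  have "card (insert e C) = card B"
    using sp ind[OF oI] ind[OF B] by (metis dim_eq_card_independent dim_span)
  then have "Suc (card C) = card B" using \<open>finite C\<close> eC by simp
  then show ?thesis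
    using that[OF oC eC C0] span_lborel_cong[OF B oI] sp \<open>card (insert e C) = card B\<close> by simp
qed

lemma sphere_vol_pos: "sphere_vol n > 0"
  unfolding sphere_vol_def by (intro divide_pos_pos mult_pos_pos Gamma_real_pos) auto

text \<open>In dimension \<open>d\<close>, differentiating the ball volume
  \<open>v * sqrt s ^ d\<close> in \<open>s\<close> gives
  \<open>v * d / 2 * sqrt s ^ (d - 2)\<close>, and \<open>d * v\<close> is the sphere volume; hence
  the half and the exponent. Writing \<open>d\<close> as \<open>Suc (Suc n)\<close> keeps the
  exponent natural. The test \<open>s > 0\<close> matters: \<open>sqrt\<close> is odd, so its even
  powers are positive at negative \<open>s\<close>.\<close>

lemma nn_integral_span_lborel_inner_self:
  assumes B: "orthonormal B" and d: "card B = Suc (Suc n)"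
    and [measurable]: "f \<in> borel_measurable borel"
  shows "(\<integral>\<^sup>+x. f (x \<bullet> x) \<partial>span_lborel B) =
    (\<integral>\<^sup>+s. f s * ennreal (sphere_vol (Suc n) / 2 * (if s > 0 then sqrt s ^ n else 0)) \<partial>lborel)"
proof -
  let ?v = "unit_ball_vol (card B)"
  let ?l = "\<lambda>s::real. sphere_vol (Suc n) / 2 * (if s > 0 then sqrt s ^ n else 0)"
  have v: "sphere_vol (Suc n) = real (card B) * ?v"
    by (simp add: sphere_vol_unit_ball_vol d add_ac)
  have "distr (span_lborel B) borel (\<lambda>x. x \<bullet> x) = density lborel (\<lambda>s. ennreal (?l s))"
  proof (rule measure_eqI_generator_eq)
    show "Int_stable (range (\<lambda>a::real. {..a}))"
      by (auto simp: Int_stable_def)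
    show "sets (distr (span_lborel B) borel (\<lambda>x. x \<bullet> x)) = sigma_sets UNIV (range (\<lambda>a::real. {..a}))"
      by (simp add: borel_eq_atMost)
    show "sets (density lborel (\<lambda>s. ennreal (?l s))) = sigma_sets UNIV (range (\<lambda>a::real. {..a}))"
      by (simp add: borel_eq_atMost)
    have ball: "emeasure (distr (span_lborel B) borel (\<lambda>x. x \<bullet> x)) {..r} = emeasure (span_lborel B) {x. x \<bullet> x \<le> r}" for r
      by (subst emeasure_distr) (auto intro!: arg_cong[where f = "emeasure _"])
    have ball_pos: "emeasure (distr (span_lborel B) borel (\<lambda>x. x \<bullet> x)) {..r} = ennreal (?v * sqrt r ^ card B)"
      if "r > 0" for r
      using ball emeasure_span_lborel_ball[OF B that] by simp
    \<comment> \<open>The set contains at most the origin, and balls around the origin shrink to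
      volume 0 because the dimension is positive.\<close>
    have ball0: "emeasure (distr (span_lborel B) borel (\<lambda>x. x \<bullet> x)) {..r} = 0" if "r \<le> 0" for r
    proof -
      have "emeasure (span_lborel B) {x. x \<bullet> x \<le> r} \<le> ennreal (?v * sqrt e ^ card B)" if "e > 0" for e
        unfolding emeasure_span_lborel_ball[OF B that, symmetric] using \<open>r \<le> 0\<close> that
        by (intro emeasure_mono) auto
      moreover have "((\<lambda>e. ennreal (?v * sqrt e ^ card B)) \<longlongrightarrow> ennreal (?v * sqrt 0 ^ card B)) (at_right 0)"
        by (intro tendsto_intros)
      moreover have "\<forall>\<^sub>F e::real in at_right 0. 0 < e" by (rule eventually_at_right_less)
      ultimately have "emeasure (span_lborel B) {x. x \<bullet> x \<le> r} \<le> ennreal (?v * sqrt 0 ^ card B)"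
        by (intro tendsto_lowerbound[where F = "at_right (0::real)"]) (auto elim: eventually_mono)
      then show ?thesis using ball d by simp
    qed
    show "emeasure (distr (span_lborel B) borel (\<lambda>x. x \<bullet> x)) X = emeasure (density lborel (\<lambda>s. ennreal (?l s))) X"
      if XR: "X \<in> range (\<lambda>a::real. {..a})" for X
    proof -
      obtain r where X: "X = {..r}" using XR by blast
      have dens: "emeasure (density lborel (\<lambda>s. ennreal (?l s))) X = (\<integral>\<^sup>+s. ennreal (?l s * indicator {0..r} s) \<partial>lborel)"
        unfolding X
        by (subst emeasure_density) (auto intro!: nn_integral_cong simp: indicator_def)
      show ?thesis
      proof (cases "r > 0")
        case False
        then have "(\<lambda>s. ennreal (?l s * indicator {0..r} s)) = (\<lambda>_. 0)"
          by (auto simp: fun_eq_iff split: split_indicator)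
        then show ?thesis unfolding dens using ball0[of r] False X by simp
      next
        case True
        \<comment> \<open>\<open>sqrt\<close> is not differentiable at 0, so the derivative is asked
          for in the interior only.\<close>
        have "(?l has_integral (?v * sqrt r ^ card B - ?v * sqrt 0 ^ card B)) {0..r}"
        proof (rule fundamental_theorem_of_calculus_interior)
          fix s assume s: "s \<in> {0<..<r}"
          have "((\<lambda>s. ?v * sqrt s ^ card B) has_real_derivative
              ?v * (real (card B) * (inverse (sqrt s) / 2) * sqrt s ^ (card B - 1))) (at s)"
            using s by (auto intro!: derivative_eq_intros)
          also have "?v * (real (card B) * (inverse (sqrt s) / 2) * sqrt s ^ (card B - 1)) = ?l s"
            using s by (simp add: v d field_simps)
          finally show "((\<lambda>s. ?v * sqrt s ^ card B) has_vector_derivative ?l s) (at s)"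
            by (simp add: has_real_derivative_iff_has_vector_derivative)
        qed (use True in \<open>auto intro!: continuous_intros\<close>)
        then have "(?l has_integral (?v * sqrt r ^ card B)) {0..r}"
          using d by simp
        moreover have "(\<lambda>s. ?l s * indicator {0..r} s) = (\<lambda>s. if s \<in> {0..r} then ?l s else 0)"
          by (auto simp: fun_eq_iff)
        ultimately have "((\<lambda>s. ?l s * indicator {0..r} s) has_integral (?v * sqrt r ^ card B)) UNIV"
          by (simp only: has_integral_restrict_UNIV)
        then have "(\<integral>\<^sup>+s. ennreal (?l s * indicator {0..r} s) \<partial>lborel) = ennreal (?v * sqrt r ^ card B)"
          by (intro nn_integral_has_integral_lborel) (auto simp: less_imp_le[OF sphere_vol_pos] intro!: mult_nonneg_nonneg)
        then show ?thesis using dens ball_pos[OF True] X by simp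
      qed
    qed
    show "range (\<lambda>n. {..real n}) \<subseteq> range (\<lambda>a::real. {..a})" by auto
    show "(\<Union>n. {..real n}) = UNIV" by (auto simp: real_arch_simple)
    show "emeasure (distr (span_lborel B) borel (\<lambda>x. x \<bullet> x)) {..real n} \<noteq> \<infinity>" for n
      using ball0[of "real n"] ball_pos[of "real n"] by (cases "real n > 0") auto
  qed simp
  then have "(\<integral>\<^sup>+s. f s \<partial>distr (span_lborel B) borel (\<lambda>x. x \<bullet> x)) = (\<integral>\<^sup>+s. f s \<partial>density lborel (\<lambda>s. ennreal (?l s)))"
    by simp
  then show ?thesis
    by (simp add: nn_integral_distr nn_integral_density mult.commute)
qed

subsection \<open>Gram matrices and Schur complements\<close>

definition upairs :: "'i set \<Rightarrow> 'i uprod set" where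
  "upairs I = {p. set_uprod p \<subseteq> I}"

lemma Upair_in_upairs [simp]: "Upair i j \<in> upairs I \<longleftrightarrow> i \<in> I \<and> j \<in> I"
  by (simp add: upairs_def)

lemma upairs_empty [simp]: "upairs {} = {}"
proof -
  have "p \<notin> upairs {}" for p :: "'i uprod" by (cases p) simp
  then show ?thesis by blast
qed

lemma upairs_UNIV [simp]: "upairs UNIV = UNIV"
  by (simp add: upairs_def)

lemma upairs_insert: "upairs (insert a I) = insert (Upair a a) (upairs I \<union> Upair a ` I)"
proof (intro set_eqI)
  fix p show "p \<in> upairs (insert a I) \<longleftrightarrow> p \<in> insert (Upair a a) (upairs I \<union> Upair a ` I)"
    by (cases p) auto
qed

lift_definition outer_commute :: "('i \<Rightarrow> real) \<Rightarrow> ('i, real) commute"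
  is "\<lambda>w i j. w i * w j" by simp

definition outer :: "('i \<Rightarrow> real) \<Rightarrow> 'i uprod \<Rightarrow> real" where
  "outer w p = case_uprod (outer_commute w) p"

lemma outer_Upair [simp]: "outer w (Upair i j) = w i * w j"
  by (simp add: outer_def outer_commute.rep_eq)

lift_definition gram_commute :: "('i \<Rightarrow> 'a::real_inner) \<Rightarrow> ('i, real) commute"
  is "\<lambda>v i j. v i \<bullet> v j" by (simp add: inner_commute)

definition gram :: "('i \<Rightarrow> 'a::real_inner) \<Rightarrow> 'i uprod \<Rightarrow> real" where
  "gram v p = case_uprod (gram_commute v) p"

lemma gram_Upair [simp]: "gram v (Upair i j) = v i \<bullet> v j"
  by (simp add: gram_def gram_commute.rep_eq)

text \<open>
  The determinant of the submatrix with rows and columns in \<open>I\<close>, as the determinant of its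
  extension by the identity: a subset of the index type is not itself a type.
\<close>

definition subdet :: "'i::finite set \<Rightarrow> ('i uprod \<Rightarrow> real) \<Rightarrow> real" where
  "subdet I u = det (\<chi> i j. if i \<in> I \<and> j \<in> I then u (Upair i j) else if i = j then 1 else 0)"

lemma subdet_cong: "(\<And>p. p \<in> upairs I \<Longrightarrow> u p = u' p) \<Longrightarrow> subdet I u = subdet I u'"
  by (auto simp: subdet_def intro!: arg_cong[where f = det] simp: vec_eq_iff)

text \<open>The restriction makes the value a point of the product space over
  \<open>upairs I\<close>. At a zero pivot the quotient is 0 by convention; the region
  \<open>D'\<close> used below demands a positive pivot.\<close>

definition schur :: "'i \<Rightarrow> 'i set \<Rightarrow> ('i uprod \<Rightarrow> real) \<Rightarrow> 'i uprod \<Rightarrow> real" where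
  "schur a I u = (\<lambda>p\<in>upairs I. u p - outer (\<lambda>i. u (Upair a i)) p / u (Upair a a))"

text \<open>Block elimination: \<open>M = L D L^T\<close>, where \<open>L\<close> is the identity
  with the multipliers \<open>w i / s\<close> added in column \<open>a\<close>, and \<open>D\<close>
  carries the pivot and the Schur complement.\<close>

lemma subdet_insert:
  fixes I :: "'i::finite set"
  assumes a: "a \<notin> I" and s: "u (Upair a a) \<noteq> 0"
  shows "subdet (insert a I) u = u (Upair a a) * subdet I (schur a I u)"
proof -
  define s where "s = u (Upair a a)"
  define w where "w i = u (Upair a i)" for i
  have "s \<noteq> 0" using s by (simp add: s_def)
  have w': "u (Upair i a) = w i" for i
    by (metis Upair_inject w_def)
  have wa: "w a = s" by (simp add: w_def s_def)
  define L :: "real^'i^'i" where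
    "L = (\<chi> i j. (if j = i then 1 else 0) + (if j = a then (if i \<in> I then w i / s else 0) else 0))"
  define P :: "real^'i^'i" where
    "P = (\<chi> i j. if i \<in> I \<and> j \<in> I then schur a I u (Upair i j) else if i = j then 1 else 0)"
  \<comment> \<open>As \<open>a\<close> is not in \<open>I\<close>, row \<open>a\<close> of
    \<open>P\<close> is a unit row; scaling it puts the pivot on the diagonal.\<close>
  define D :: "real^'i^'i" where "D = (\<chi> i. if i = a then s *s row a P else row i P)"
  define M :: "real^'i^'i" where
    "M = (\<chi> i j. if i \<in> insert a I \<and> j \<in> insert a I then u (Upair i j) else if i = j then 1 else 0)"
  have Lsum: "(\<Sum>k\<in>UNIV. L $ i $ k * f k) = f i + (if i \<in> I then w i / s else 0) * f a" for i f
  proof -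
    have "(\<Sum>k\<in>UNIV. L $ i $ k * f k) = (\<Sum>k\<in>UNIV. (if k = i then f k else 0) +
       (if k = a then (if i \<in> I then w i / s else 0) * f k else 0))"
      by (intro sum.cong) (auto simp: L_def algebra_simps)
    also have "\<dots> = f i + (if i \<in> I then w i / s else 0) * f a"
      by (simp add: sum.distrib)
    finally show ?thesis .
  qed
  then have Lsum': "(\<Sum>k\<in>UNIV. f k * L $ i $ k) = f i + (if i \<in> I then w i / s else 0) * f a" for i f
    by (simp add: mult.commute)
  have Pij: "P $ i $ j = (if i \<in> I \<and> j \<in> I then u (Upair i j) - w i * w j / s else if i = j then 1 else 0)" for i j
    by (simp add: P_def schur_def w_def s_def)
  have Dij: "D $ i $ j = (if i = a then (if j = a then s else 0) else P $ i $ j)" for i j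
    using a by (auto simp: D_def row_def Pij)
  have "M = (L ** D) ** transpose L"
    unfolding vec_eq_iff
  proof (intro allI)
    fix i j
    have "((L ** D) ** transpose L) $ i $ j =
       (D $ i $ j + (if i \<in> I then w i / s else 0) * D $ a $ j) +
       (if j \<in> I then w j / s else 0) * (D $ i $ a + (if i \<in> I then w i / s else 0) * D $ a $ a)"
      by (simp add: matrix_matrix_mult_def transpose_def Lsum Lsum')
    also have "\<dots> = M $ i $ j"
      using a \<open>s \<noteq> 0\<close> wa by (auto simp: Dij Pij M_def w' s_def[symmetric] w_def[symmetric])
    finally show "M $ i $ j = ((L ** D) ** transpose L) $ i $ j" by simp
  qed
  \<comment> \<open>\<open>transpose L\<close> arises from the identity by adding to row
    \<open>a\<close> a combination \<open>x\<close> of the other rows.\<close>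
  moreover have "det (transpose L) = 1"
  proof -
    define x :: "real^'i" where "x = (\<Sum>j\<in>I. (w j / s) *s row j (mat 1))"
    have "x \<in> vec.span {row j (mat 1 :: real^'i^'i) |j. j \<noteq> a}"
      unfolding x_def using a by (intro vec.span_sum vec.span_scale vec.span_base) auto
    then have "det (\<chi> k. if k = a then row a (mat 1) + x else row k (mat 1 :: real^'i^'i)) = det (mat 1 :: real^'i^'i)"
      by (rule det_row_span)
    moreover have "x $ j = (if j \<in> I then w j / s else 0)" for j
      by (simp add: x_def row_def mat_def if_distrib cong: if_cong)
    then have "(\<chi> k. if k = a then row a (mat 1) + x else row k (mat 1 :: real^'i^'i)) = transpose L"
      by (auto simp: vec_eq_iff transpose_def L_def row_def mat_def)
    ultimately show ?thesis by simp
  qed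
  moreover have "det D = s * det P"
  proof -
    have "(\<chi> i. if i = a then row a P else row i P) = P"
      by (simp add: vec_eq_iff row_def)
    then show ?thesis
      using det_row_mul[of a s "\<lambda>_. row a P" "\<lambda>i. row i P"] by (simp add: D_def)
  qed
  ultimately have "det M = s * det P"
    by (simp add: det_mul)
  then show ?thesis
    by (simp add: subdet_def M_def P_def s_def)
qed

lemma subdet_eq_0_zero_row:
  assumes "a \<in> I" "\<And>i. i \<in> I \<Longrightarrow> u (Upair a i) = 0"
  shows "subdet I u = 0"
  unfolding subdet_def
  by (rule det_zero_row(1)[of a]) (use assms in \<open>auto simp: row_def vec_eq_iff\<close>)

lemma measurable_subdet [measurable]:
  fixes I :: "'i::finite set"
  shows "(\<lambda>u. subdet I u) \<in> borel_measurable (PiM (upairs I) (\<lambda>_. lborel))"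
proof -
  have comp: "(\<lambda>u. if i \<in> I \<and> j \<in> I then u (Upair i j) else if i = j then 1 else 0)
      \<in> borel_measurable (PiM (upairs I) (\<lambda>_. lborel :: real measure))" for i j
  proof (cases "i \<in> I \<and> j \<in> I")
    case True
    then have "(\<lambda>u. u (Upair i j)) \<in> measurable (PiM (upairs I) (\<lambda>_. lborel)) lborel"
      by (intro measurable_component_singleton) simp
    with True show ?thesis by simp
  next
    case False
    then have eq: "(\<lambda>u. if i \<in> I \<and> j \<in> I then u (Upair i j) else if i = j then 1 else 0) =
        (\<lambda>u::'i uprod \<Rightarrow> real. if i = j then 1 else 0 :: real)"
      by (simp only: if_False)
    show ?thesis by (subst eq) (rule borel_measurable_const)
  qed
  show ?thesis
    unfolding subdet_def det_def vec_lambda_beta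
    by (intro borel_measurable_sum borel_measurable_times borel_measurable_prod borel_measurable_const comp)
qed

lemma measurable_schur [measurable]:
  "schur a I \<in> PiM (upairs (insert a I)) (\<lambda>_. lborel) \<rightarrow>\<^sub>M PiM (upairs I) (\<lambda>_. lborel)"
proof -
  have [measurable]: "(\<lambda>u. u p) \<in> borel_measurable (PiM (upairs (insert a I)) (\<lambda>_. lborel))"
    if "p \<in> upairs (insert a I)" for p
    using measurable_component_singleton[OF that, of "\<lambda>_. lborel"] by simp
  have "(\<lambda>u. u p - outer (\<lambda>i. u (Upair a i)) p / u (Upair a a))
     \<in> borel_measurable (PiM (upairs (insert a I)) (\<lambda>_. lborel))" if "p \<in> upairs I" for p
    using that by (cases p) simp
  then show ?thesis
    unfolding schur_def by (intro measurable_restrict) simp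
qed

section \<open>Corner, border and block of a symmetric matrix as separate coordinates\<close>

text \<open>Reverses the reading off of corner, border and block. A border entry is given by an
  unordered pair, so its index is recovered by inverting \<open>Upair a\<close>.\<close>

definition bordered :: "'i \<Rightarrow> 'i set \<Rightarrow> real \<Rightarrow> ('i \<Rightarrow> real) \<Rightarrow> ('i uprod \<Rightarrow> real) \<Rightarrow> 'i uprod \<Rightarrow> real" where
  "bordered a I s w u = (\<lambda>p\<in>upairs (insert a I).
     if p = Upair a a then s else if p \<in> upairs I then u p else w (the_inv_into I (Upair a) p))"

lemma inj_Upair: "inj_on (Upair a) I"
  by (auto simp: inj_on_def)

lemma bordered_simps:
  assumes "a \<notin> I"
  shows "bordered a I s w u (Upair a a) = s"
    and "i \<in> I \<Longrightarrow> bordered a I s w u (Upair a i) = w i"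
    and "p \<in> upairs I \<Longrightarrow> bordered a I s w u p = u p"
  using assms the_inv_into_f_f[OF inj_Upair, of i I a] by (auto simp: bordered_def upairs_insert)

lemma schur_bordered:
  assumes "a \<notin> I"
  shows "schur a I (bordered a I s w u) = (\<lambda>p\<in>upairs I. u p - outer w p / s)"
proof -
  have "outer (\<lambda>i. bordered a I s w u (Upair a i)) p = outer w p" if "p \<in> upairs I" for p
    using that assms by (cases p) (simp add: bordered_simps)
  then show ?thesis
    using assms by (auto simp: schur_def bordered_simps fun_eq_iff)
qed

lemma measurable_bordered [measurable (raw)]:
  assumes [measurable]: "s \<in> borel_measurable N" and w: "w \<in> N \<rightarrow>\<^sub>M PiM I (\<lambda>_. lborel)"
    and u: "u \<in> N \<rightarrow>\<^sub>M PiM (upairs I) (\<lambda>_. lborel)"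
  shows "(\<lambda>x. bordered a I (s x) (w x) (u x)) \<in> N \<rightarrow>\<^sub>M PiM (upairs (insert a I)) (\<lambda>_. lborel)"
proof -
  have w': "(\<lambda>x. w x i) \<in> borel_measurable N" if "i \<in> I" for i
    using measurable_compose[OF w measurable_component_singleton[OF that, of "\<lambda>_. lborel"]] by simp
  have u': "(\<lambda>x. u x p) \<in> borel_measurable N" if "p \<in> upairs I" for p
    using measurable_compose[OF u measurable_component_singleton[OF that, of "\<lambda>_. lborel"]] by simp
  have "(\<lambda>x. if p = Upair a a then s x else if p \<in> upairs I then u x p
       else w x (the_inv_into I (Upair a) p)) \<in> borel_measurable N" if "p \<in> upairs (insert a I)" for p
  proof -
    have "p = Upair a a \<or> p \<in> upairs I \<or> (\<exists>i\<in>I. p = Upair a i)"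
      using that by (auto simp: upairs_insert)
    then show ?thesis
      using the_inv_into_f_f[OF inj_Upair[of a I]] u' w' assms(1)
      by (cases "p = Upair a a"; cases "p \<in> upairs I") auto
  qed
  then show ?thesis
    unfolding bordered_def by (intro measurable_restrict) simp
qed

text \<open>The index set is the disjoint union of the corner, the border pairs and
  \<open>upairs I\<close>. Tonelli splits the integral accordingly, and injectivity of
  \<open>Upair a\<close> lets \<open>I\<close> index the border.\<close>

lemma nn_integral_bordered:
  assumes a: "a \<notin> I" and [simp]: "finite I" "finite (upairs I)"
    and f[measurable]: "f \<in> borel_measurable (PiM (upairs (insert a I)) (\<lambda>_. lborel))"
  shows "(\<integral>\<^sup>+u. f u \<partial>PiM (upairs (insert a I)) (\<lambda>_. lborel)) =
    (\<integral>\<^sup>+s. \<integral>\<^sup>+w. \<integral>\<^sup>+u. f (bordered a I s w u) \<partial>PiM (upairs I) (\<lambda>_. lborel) \<partial>PiM I (\<lambda>_. lborel) \<partial>lborel)"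
proof -
  interpret product_sigma_finite "\<lambda>_::'a uprod. lborel :: real measure"
    by (rule product_sigma_finite_lborel)
  interpret U: sigma_finite_measure "PiM (upairs I) (\<lambda>_. lborel :: real measure)"
    by (rule sigma_finite) simp
  have disj: "Upair a a \<notin> Upair a ` I \<union> upairs I" "Upair a ` I \<inter> upairs I = {}"
    using a by auto
  have ins: "insert (Upair a a) (Upair a ` I \<union> upairs I) = upairs (insert a I)"
    by (auto simp: upairs_insert)
  have [measurable]: "f \<in> borel_measurable (PiM (insert (Upair a a) (Upair a ` I \<union> upairs I)) (\<lambda>_. lborel))"
    using f by (simp only: ins)
  have "(\<integral>\<^sup>+u. f u \<partial>PiM (insert (Upair a a) (Upair a ` I \<union> upairs I)) (\<lambda>_. lborel)) =
     (\<integral>\<^sup>+s. \<integral>\<^sup>+z. f (z(Upair a a := s)) \<partial>PiM (Upair a ` I \<union> upairs I) (\<lambda>_. lborel) \<partial>lborel)"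
    using disj by (intro product_nn_integral_insert_rev) auto
  also have "\<dots> = (\<integral>\<^sup>+s. \<integral>\<^sup>+w. \<integral>\<^sup>+u. f (bordered a I s w u) \<partial>PiM (upairs I) (\<lambda>_. lborel) \<partial>PiM I (\<lambda>_. lborel) \<partial>lborel)"
  proof (rule nn_integral_cong)
    fix s :: real
    have "(\<lambda>z. f (z(Upair a a := s))) \<in> borel_measurable (PiM (Upair a ` I \<union> upairs I) (\<lambda>_. lborel))"
      by (rule measurable_compose[OF measurable_fun_upd[where J = "Upair a ` I \<union> upairs I"]]) (auto, measurable)
    then have "(\<integral>\<^sup>+z. f (z(Upair a a := s)) \<partial>PiM (Upair a ` I \<union> upairs I) (\<lambda>_. lborel)) =
      (\<integral>\<^sup>+x. \<integral>\<^sup>+u. f ((merge (Upair a ` I) (upairs I) (x, u))(Upair a a := s))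
         \<partial>PiM (upairs I) (\<lambda>_. lborel) \<partial>PiM (Upair a ` I) (\<lambda>_. lborel))"
      using disj by (intro product_nn_integral_fold) auto
    also have "\<dots> = (\<integral>\<^sup>+x. \<integral>\<^sup>+u. f (bordered a I s (\<lambda>i\<in>I. x (Upair a i)) u)
         \<partial>PiM (upairs I) (\<lambda>_. lborel) \<partial>PiM (Upair a ` I) (\<lambda>_. lborel))"
    proof (intro nn_integral_cong arg_cong[where f = f] ext)
      fix x u p
      show "((merge (Upair a ` I) (upairs I) (x, u))(Upair a a := s)) p = bordered a I s (\<lambda>i\<in>I. x (Upair a i)) u p"
      proof -
        have "p = Upair a a \<or> p \<in> upairs I \<or> (\<exists>i\<in>I. p = Upair a i) \<or> p \<notin> upairs (insert a I)"
          by (auto simp: upairs_insert)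
        then show ?thesis
        proof (elim disjE bexE)
          assume "p \<in> upairs I"
          moreover have "p \<noteq> Upair a a" "p \<notin> Upair a ` I" using \<open>p \<in> upairs I\<close> disj by auto
          ultimately show ?thesis using a by (simp add: bordered_simps merge_def)
        next
          fix i assume i: "i \<in> I" "p = Upair a i"
          then have "i \<noteq> a" using a by blast
          with i show ?thesis using a by (simp add: bordered_simps merge_def)
        next
          assume p: "p \<notin> upairs (insert a I)"
          then have "p \<noteq> Upair a a" "p \<notin> Upair a ` I \<union> upairs I"
            unfolding upairs_insert by blast+
          with p show ?thesis by (simp add: bordered_def merge_def)
        qed (simp add: bordered_simps a)
      qed
    qed
    also have "\<dots> = (\<integral>\<^sup>+w. \<integral>\<^sup>+u. f (bordered a I s w u) \<partial>PiM (upairs I) (\<lambda>_. lborel) \<partial>PiM I (\<lambda>_. lborel))"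
      by (rule nn_integral_PiM_reindex[symmetric, OF lborel.sigma_finite_measure_axioms _ inj_Upair])
         (simp, measurable)
    finally show "(\<integral>\<^sup>+z. f (z(Upair a a := s)) \<partial>PiM (Upair a ` I \<union> upairs I) (\<lambda>_. lborel)) =
      (\<integral>\<^sup>+w. \<integral>\<^sup>+u. f (bordered a I s w u) \<partial>PiM (upairs I) (\<lambda>_. lborel) \<partial>PiM I (\<lambda>_. lborel))" .
  qed
  finally show ?thesis by (simp only: ins)
qed

subsection \<open>The distribution of the Gram matrix\<close>

lemma measurable_gram [measurable (raw)]:
  fixes v :: "'x \<Rightarrow> 'i \<Rightarrow> 'a::euclidean_space"
  assumes v: "\<And>i. i \<in> I \<Longrightarrow> (\<lambda>x. v x i) \<in> borel_measurable N"
  shows "(\<lambda>x. \<lambda>p\<in>upairs I. gram (v x) p) \<in> N \<rightarrow>\<^sub>M PiM (upairs I) (\<lambda>_. lborel)"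
proof (rule measurable_restrict)
  fix p assume "p \<in> upairs I"
  then show "(\<lambda>x. gram (v x) p) \<in> N \<rightarrow>\<^sub>M lborel"
    by (cases p) (auto intro: borel_measurable_inner v)
qed

text \<open>Tonelli for the coordinate along \<open>e\<close>. It presents the measure as an image
  of a product, the form that \<open>nn_integral_PiM_distr_pair\<close> takes.\<close>

lemma span_lborel_insert:
  assumes C: "orthonormal C" and e: "e \<notin> C"
  shows "span_lborel (insert e C) = distr (lborel \<Otimes>\<^sub>M span_lborel C) borel (\<lambda>(t, y). t *\<^sub>R e + y)"
proof (rule measure_eqI)
  interpret product_sigma_finite "\<lambda>_::'a. lborel :: real measure"
    by (rule product_sigma_finite_lborel)
  interpret C: sigma_finite_measure "span_lborel C" by (rule sigma_finite_span_lborel[OF C])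
  have "finite C" using C by (simp add: orthonormal_def)
  fix A :: "'a set" assume "A \<in> sets (span_lborel (insert e C))"
  then have A[measurable]: "A \<in> sets borel" by simp
  have ind[measurable]: "(indicator A :: 'a \<Rightarrow> ennreal) \<in> borel_measurable borel" by simp
  have "emeasure (span_lborel (insert e C)) A = (\<integral>\<^sup>+x. indicator A x \<partial>span_lborel (insert e C))"
    by simp
  also have "\<dots> = (\<integral>\<^sup>+f. indicator A (\<Sum>b\<in>insert e C. f b *\<^sub>R b) \<partial>PiM (insert e C) (\<lambda>_. lborel))"
    by (rule nn_integral_span_lborel) measurable
  also have "\<dots> = (\<integral>\<^sup>+t. \<integral>\<^sup>+f. indicator A (\<Sum>b\<in>insert e C. (f(e := t)) b *\<^sub>R b) \<partial>PiM C (\<lambda>_. lborel) \<partial>lborel)"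
    using \<open>finite C\<close> e by (intro product_nn_integral_insert_rev) (auto intro: measurable_compose[OF measurable_coordinates_sum ind])
  also have "\<dots> = (\<integral>\<^sup>+t. \<integral>\<^sup>+f. indicator A (t *\<^sub>R e + (\<Sum>b\<in>C. f b *\<^sub>R b)) \<partial>PiM C (\<lambda>_. lborel) \<partial>lborel)"
  proof -
    have "(\<Sum>b\<in>insert e C. (f(e := t)) b *\<^sub>R b) = t *\<^sub>R e + (\<Sum>b\<in>C. f b *\<^sub>R b)" for f t
      using \<open>finite C\<close> e by (simp add: sum.insert) (intro sum.cong, auto)
    then show ?thesis by (simp only:)
  qed
  also have "\<dots> = (\<integral>\<^sup>+t. \<integral>\<^sup>+y. indicator A (t *\<^sub>R e + y) \<partial>span_lborel C \<partial>lborel)"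
    by (intro nn_integral_cong nn_integral_span_lborel[symmetric]) measurable
  also have "\<dots> = (\<integral>\<^sup>+z. indicator A (case z of (t, y) \<Rightarrow> t *\<^sub>R e + y) \<partial>(lborel \<Otimes>\<^sub>M span_lborel C))"
    by (subst C.nn_integral_fst[symmetric]) (simp_all add: split_beta')
  also have "\<dots> = (\<integral>\<^sup>+x. indicator A x \<partial>distr (lborel \<Otimes>\<^sub>M span_lborel C) borel (\<lambda>(t, y). t *\<^sub>R e + y))"
    by (rule nn_integral_distr[symmetric]) measurable
  also have "\<dots> = emeasure (distr (lborel \<Otimes>\<^sub>M span_lborel C) borel (\<lambda>(t, y). t *\<^sub>R e + y)) A"
    by simp
  finally show "emeasure (span_lborel (insert e C)) A =
     emeasure (distr (lborel \<Otimes>\<^sub>M span_lborel C) borel (\<lambda>(t, y). t *\<^sub>R e + y)) A" .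
qed simp

text \<open>A cylinder over a null set is null even when the other factors have infinite mass,
  because a product with a factor 0 is 0 in \<open>ennreal\<close>.\<close>

lemma AE_PiM_component_sigma_finite:
  assumes M: "sigma_finite_measure M" and I: "finite I" and P: "AE x in M. P x"
  shows "AE v in PiM I (\<lambda>_. M). \<forall>i\<in>I. P (v i)"
proof -
  interpret product_sigma_finite "\<lambda>_::'b. M" by (rule product_sigma_finite_const[OF M])
  obtain N where N: "{x \<in> space M. \<not> P x} \<subseteq> N" "emeasure M N = 0" "N \<in> sets M"
    using P by (rule AE_E)
  have "AE v in PiM I (\<lambda>_. M). P (v i)" if "i \<in> I" for i
  proof (rule AE_I)
    let ?N = "\<Pi>\<^sub>E j\<in>I. if j = i then N else space M"
    show "{v \<in> space (PiM I (\<lambda>_. M)). \<not> P (v i)} \<subseteq> ?N"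
      using N(1) that by (auto simp: space_PiM PiE_iff extensional_def)
    show "?N \<in> sets (PiM I (\<lambda>_. M))"
      using N I by (intro sets_PiM_I_finite) auto
    have "emeasure (PiM I (\<lambda>_. M)) ?N = (\<Prod>j\<in>I. emeasure M (if j = i then N else space M))"
      using N I by (intro emeasure_PiM) auto
    also have "\<dots> = 0" using N I that by (auto simp: prod_zero_iff)
    finally show "emeasure (PiM I (\<lambda>_. M)) ?N = 0" .
  qed
  then show ?thesis using I by (simp add: AE_finite_all)
qed

text \<open>Half a sphere volume per vector, the factor for \<open>q\<close> coming from dimension
  \<open>p + q + 1\<close>. For \<open>p = m - k - 1\<close> these are the spheres of the theorem in
  reverse order.\<close>

definition gram_const :: "nat \<Rightarrow> nat \<Rightarrow> real" where
  "gram_const p n = (\<Prod>q=1..n. sphere_vol (p + q) / 2)"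

lemma gram_const_pos: "gram_const p n > 0"
  unfolding gram_const_def by (intro prod_pos) (simp add: sphere_vol_pos)

text \<open>The cut-off \<open>D\<close> cannot be a sign condition on the determinant, which is
  also positive at some indefinite or negative definite matrices.\<close>

definition gram_weight :: "nat \<Rightarrow> (('i::finite uprod \<Rightarrow> real) \<Rightarrow> bool) \<Rightarrow> 'i set \<Rightarrow> ('i uprod \<Rightarrow> real) \<Rightarrow> ennreal" where
  "gram_weight p D I u = (if D u then ennreal (sqrt (subdet I u) ^ p) else 0)"

lemma measurable_gram_weight [measurable]:
  assumes [measurable]: "Measurable.pred (PiM (upairs I) (\<lambda>_. lborel)) D"
  shows "gram_weight p D I \<in> borel_measurable (PiM (upairs I) (\<lambda>_. lborel))"
  unfolding gram_weight_def by measurable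

text \<open>One induction step with vector \<open>a\<close> frozen at \<open>sqrt s\<close> times
  \<open>e\<close>. Of the exponent \<open>card I + p\<close>, the part \<open>card I\<close> comes
  from substituting \<open>w = sqrt s * t\<close> and the part \<open>p\<close> from the ratio
  \<open>s\<close> between the two determinants. The induction hypothesis enters for the one set
  \<open>C\<close>, which is chosen after \<open>e\<close>.\<close>

lemma gram_vector_decomposition:
  fixes F :: "('i::finite uprod \<Rightarrow> real) \<Rightarrow> ennreal" and C :: "'a::euclidean_space set"
  assumes C: "orthonormal C" and e: "e \<notin> C" "e \<bullet> e = 1" "\<And>x. x \<in> span C \<Longrightarrow> x \<bullet> e = 0"
    and a: "a \<notin> I" and s: "s > 0"
    and D[measurable]: "Measurable.pred (PiM (upairs I) (\<lambda>_. lborel)) D"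
    and IH: "\<And>F. F \<in> borel_measurable (PiM (upairs I) (\<lambda>_. lborel)) \<Longrightarrow>
      (\<integral>\<^sup>+v. F (\<lambda>p\<in>upairs I. gram v p) \<partial>PiM I (\<lambda>_. span_lborel C)) =
      ennreal c * (\<integral>\<^sup>+u. F u * gram_weight p D I u \<partial>PiM (upairs I) (\<lambda>_. lborel))"
    and F[measurable]: "F \<in> borel_measurable (PiM (upairs (insert a I)) (\<lambda>_. lborel))"
    and "c \<ge> 0"
    and D': "\<And>u. D' u \<longleftrightarrow> u (Upair a a) > 0 \<and> D (schur a I u)"
  shows "(\<integral>\<^sup>+v. F (\<lambda>p\<in>upairs (insert a I). gram (v(a := sqrt s *\<^sub>R e)) p) \<partial>PiM I (\<lambda>_. span_lborel (insert e C))) =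
    ennreal (c / sqrt s ^ (card I + p)) *
    (\<integral>\<^sup>+w. \<integral>\<^sup>+u. F (bordered a I s w u) * gram_weight p D' (insert a I) (bordered a I s w u)
        \<partial>PiM (upairs I) (\<lambda>_. lborel) \<partial>PiM I (\<lambda>_. lborel))"
proof -
  let ?L = "PiM I (\<lambda>_. lborel :: real measure)"
  let ?U = "PiM (upairs I) (\<lambda>_. lborel :: real measure)"
  have oI: "orthonormal (insert e C)"
    using C e span_base by (auto simp: orthonormal_def inner_commute)
  have sfI: "sigma_finite_measure (span_lborel (insert e C))" by (rule sigma_finite_span_lborel[OF oI])
  have sfC: "sigma_finite_measure (span_lborel C)" by (rule sigma_finite_span_lborel[OF C])
  interpret U: product_sigma_finite "\<lambda>_::'i uprod. lborel :: real measure" by (rule product_sigma_finite_lborel)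
  interpret U: sigma_finite_measure ?U by (rule U.sigma_finite) simp
  define q where "q = sqrt s"
  have q: "q > 0" "q * q = s" using s by (simp_all add: q_def)
  define W where "W = gram_weight p D I"
  have [measurable]: "W \<in> borel_measurable ?U" unfolding W_def by measurable
  define K where "K w = (\<integral>\<^sup>+u. F (bordered a I s w u) * W (schur a I (bordered a I s w u)) \<partial>?U)" for w
  have [measurable]: "K \<in> borel_measurable ?L" unfolding K_def by measurable
  have "(\<integral>\<^sup>+v. F (\<lambda>p\<in>upairs (insert a I). gram (v(a := q *\<^sub>R e)) p) \<partial>PiM I (\<lambda>_. span_lborel (insert e C))) =
    (\<integral>\<^sup>+t. \<integral>\<^sup>+y. F (\<lambda>p\<in>upairs (insert a I). gram ((\<lambda>i\<in>I. case (t i, y i) of (t, y) \<Rightarrow> t *\<^sub>R e + y)(a := q *\<^sub>R e)) p)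
       \<partial>PiM I (\<lambda>_. span_lborel C) \<partial>?L)"
  proof (rule nn_integral_PiM_distr_pair[OF lborel.sigma_finite_measure_axioms sfC sfI])
    show "span_lborel (insert e C) = distr (lborel \<Otimes>\<^sub>M span_lborel C) borel (\<lambda>(t, y). t *\<^sub>R e + y)"
      by (rule span_lborel_insert[OF C e(1)])
    have "(\<lambda>v. (v(a := q *\<^sub>R e)) i) \<in> borel_measurable (PiM I (\<lambda>_. borel))" if "i \<in> insert a I" for i
      using that measurable_component_singleton[of i I "\<lambda>_. borel"] by (cases "i = a") auto
    then show "(\<lambda>v. F (\<lambda>p\<in>upairs (insert a I). gram (v(a := q *\<^sub>R e)) p)) \<in> borel_measurable (PiM I (\<lambda>_. borel))"
      by (intro measurable_compose[OF _ F] measurable_gram)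
  qed (simp, measurable)
  \<comment> \<open>The factor \<open>1 *\<close> here and the summand \<open>0 +\<close> below give
    the terms the shape of the affine substitution lemma. The equality in \<open>y\<close> holds
    almost everywhere only, as it uses that \<open>y i\<close> is orthogonal to
    \<open>e\<close>.\<close>
  also have "\<dots> = (\<integral>\<^sup>+t. \<integral>\<^sup>+y. F (bordered a I s (\<lambda>i\<in>I. q * t i) (\<lambda>p\<in>upairs I. outer t p + 1 * (\<lambda>p\<in>upairs I. gram y p) p))
       \<partial>PiM I (\<lambda>_. span_lborel C) \<partial>?L)"
  proof (rule nn_integral_cong, rule nn_integral_cong_AE)
    fix t :: "'i \<Rightarrow> real"
    have "AE y in PiM I (\<lambda>_. span_lborel C). \<forall>i\<in>I. y i \<in> span C"
      by (rule AE_PiM_component_sigma_finite[OF sfC _ AE_span_lborel]) simp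
    then show "AE y in PiM I (\<lambda>_. span_lborel C).
       F (\<lambda>p\<in>upairs (insert a I). gram ((\<lambda>i\<in>I. case (t i, y i) of (t, y) \<Rightarrow> t *\<^sub>R e + y)(a := q *\<^sub>R e)) p) =
       F (bordered a I s (\<lambda>i\<in>I. q * t i) (\<lambda>p\<in>upairs I. outer t p + 1 * (\<lambda>p\<in>upairs I. gram y p) p))"
    proof eventually_elim
      case (elim y)
      let ?v = "(\<lambda>i\<in>I. case (t i, y i) of (t, y) \<Rightarrow> t *\<^sub>R e + y)(a := q *\<^sub>R e)"
      let ?b = "bordered a I s (\<lambda>i\<in>I. q * t i) (\<lambda>p\<in>upairs I. outer t p + 1 * (\<lambda>p\<in>upairs I. gram y p) p)"
      have v: "?v i = t i *\<^sub>R e + y i" "i \<noteq> a" if "i \<in> I" for i using a that by auto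
      have ye: "y i \<bullet> e = 0" "e \<bullet> y i = 0" if "i \<in> I" for i
        using elim e(3)[of "y i"] that by (simp_all add: inner_commute[of e])
      have "gram ?v p = ?b p" if "p \<in> upairs (insert a I)" for p
      proof -
        have "p = Upair a a \<or> (\<exists>i\<in>I. p = Upair a i) \<or> (\<exists>i\<in>I. \<exists>j\<in>I. p = Upair i j)"
          using that by (cases p) auto
        then show ?thesis
        proof (elim disjE bexE)
          assume "p = Upair a a"
          then show ?thesis using a q e by (simp add: bordered_simps)
        next
          fix i assume "i \<in> I" "p = Upair a i"
          then show ?thesis using a e v[of i] ye[of i]
            by (simp add: bordered_simps inner_add_right del: case_prod_conv)
        next
          fix i j assume ij: "i \<in> I" "j \<in> I" "p = Upair i j"
          then have "p \<in> upairs I" by simp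
          then show ?thesis using a ij e v[of i] v[of j] ye
            by (simp add: bordered_simps inner_add_left inner_add_right del: case_prod_conv)
        qed
      qed
      then have "(\<lambda>p\<in>upairs (insert a I). gram ?v p) = ?b"
        by (intro ext) (auto simp: bordered_def)
      then show ?case by (simp only:)
    qed
  qed
  also have "\<dots> = (\<integral>\<^sup>+t. ennreal c * (\<integral>\<^sup>+u. F (bordered a I s (\<lambda>i\<in>I. q * t i) (\<lambda>p\<in>upairs I. outer t p + 1 * u p)) * W u \<partial>?U) \<partial>?L)"
  proof (rule nn_integral_cong)
    fix t assume "t \<in> space ?L"
    have [measurable]: "(\<lambda>u. F (bordered a I s (\<lambda>i\<in>I. q * t i) (\<lambda>p\<in>upairs I. outer t p + 1 * u p))) \<in> borel_measurable ?U"
      by measurable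
    then show "(\<integral>\<^sup>+y. F (bordered a I s (\<lambda>i\<in>I. q * t i) (\<lambda>p\<in>upairs I. outer t p + 1 * (\<lambda>p\<in>upairs I. gram y p) p))
       \<partial>PiM I (\<lambda>_. span_lborel C)) = ennreal c * (\<integral>\<^sup>+u. F (bordered a I s (\<lambda>i\<in>I. q * t i) (\<lambda>p\<in>upairs I. outer t p + 1 * u p)) * W u \<partial>?U)"
      unfolding W_def by (rule IH)
  qed
  \<comment> \<open>With border \<open>q * t\<close> and corner \<open>s = q * q\<close>, the Schur
    complement of the block \<open>u\<close> is \<open>u - outer t\<close>, so translating the block
    by \<open>outer t\<close> brings in \<open>K\<close>.\<close>
  also have "\<dots> = (\<integral>\<^sup>+t. ennreal c * K (\<lambda>i\<in>I. 0 + q * t i) \<partial>?L)"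
  proof (intro nn_integral_cong arg_cong2[where f = "(*)"] refl)
    fix t assume t: "t \<in> space ?L"
    let ?w = "\<lambda>i\<in>I. q * t i"
    have sch: "schur a I (bordered a I s ?w u) = (\<lambda>p\<in>upairs I. u p - outer t p)" for u
    proof -
      have "outer ?w p / s = outer t p" if "p \<in> upairs I" for p
        using that q s by (cases p) auto
      then show ?thesis using a by (simp add: schur_bordered fun_eq_iff)
    qed
    have "K ?w = (\<integral>\<^sup>+u. F (bordered a I s ?w u) * W (schur a I (bordered a I s ?w u)) \<partial>?U)"
      by (simp add: K_def)
    also have "\<dots> = ennreal (1 ^ card (upairs I)) * (\<integral>\<^sup>+u. F (bordered a I s ?w (\<lambda>p\<in>upairs I. outer t p + 1 * u p)) *
        W (schur a I (bordered a I s ?w (\<lambda>p\<in>upairs I. outer t p + 1 * u p))) \<partial>?U)"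
      using t by (intro nn_integral_PiM_lborel_affine) (simp, simp, measurable)
    also have "\<dots> = (\<integral>\<^sup>+u. F (bordered a I s ?w (\<lambda>p\<in>upairs I. outer t p + 1 * u p)) * W u \<partial>?U)"
    proof -
      have "(\<lambda>p\<in>upairs I. (\<lambda>p\<in>upairs I. outer t p + 1 * u p) p - outer t p) = u" if "u \<in> space ?U" for u
        using that by (auto simp: space_PiM PiE_iff extensional_def fun_eq_iff)
      then show ?thesis
        unfolding sch by (simp cong: nn_integral_cong)
    qed
    finally show "(\<integral>\<^sup>+u. F (bordered a I s ?w (\<lambda>p\<in>upairs I. outer t p + 1 * u p)) * W u \<partial>?U) = K (\<lambda>i\<in>I. 0 + q * t i)"
      by simp
  qed
  also have "\<dots> = ennreal c * (\<integral>\<^sup>+t. K (\<lambda>i\<in>I. 0 + q * t i) \<partial>?L)"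
    by (rule nn_integral_cmult) measurable
  also have "(\<integral>\<^sup>+t. K (\<lambda>i\<in>I. 0 + q * t i) \<partial>?L) = ennreal (1 / q ^ card I) * (\<integral>\<^sup>+w. K w \<partial>?L)"
  proof -
    have "(\<integral>\<^sup>+w. K w \<partial>?L) = ennreal (q ^ card I) * (\<integral>\<^sup>+t. K (\<lambda>i\<in>I. 0 + q * t i) \<partial>?L)"
      using q by (intro nn_integral_PiM_lborel_affine) (simp, simp, measurable)
    moreover have "ennreal (1 / q ^ card I) * ennreal (q ^ card I) = 1"
      using q by (simp flip: ennreal_mult')
    ultimately show ?thesis by (simp flip: mult.assoc)
  qed
  also have "(\<integral>\<^sup>+w. K w \<partial>?L) = ennreal (1 / q ^ p) * (\<integral>\<^sup>+w. (\<integral>\<^sup>+u. F (bordered a I s w u) *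
      gram_weight p D' (insert a I) (bordered a I s w u) \<partial>?U) \<partial>?L)"
  proof -
    \<comment> \<open>Passing to the bordered matrix multiplies the determinant by \<open>s\<close>,
      hence the weight by \<open>q ^ p\<close>; as the corner \<open>s\<close> is positive,
      \<open>D'\<close> reduces to \<open>D\<close> of the Schur complement.\<close>
    have W': "W (schur a I (bordered a I s w u)) =
        ennreal (1 / q ^ p) * gram_weight p D' (insert a I) (bordered a I s w u)" for w u
    proof -
      let ?b = "bordered a I s w u"
      have b: "?b (Upair a a) = s" using a by (simp add: bordered_simps)
      have "subdet (insert a I) ?b = s * subdet I (schur a I ?b)"
        using subdet_insert[OF a, of ?b] s b by simp
      then have "sqrt (subdet (insert a I) ?b) ^ p = q ^ p * sqrt (subdet I (schur a I ?b)) ^ p"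
        by (simp add: q_def real_sqrt_mult power_mult_distrib)
      then show ?thesis
        using q s b by (simp add: W_def gram_weight_def D' flip: ennreal_mult')
    qed
    have [measurable]: "Measurable.pred (PiM (upairs (insert a I)) (\<lambda>_. lborel)) D'"
      unfolding D' by measurable
    have "(\<integral>\<^sup>+w. K w \<partial>?L) = (\<integral>\<^sup>+w. (\<integral>\<^sup>+u. ennreal (1 / q ^ p) * (F (bordered a I s w u) *
        gram_weight p D' (insert a I) (bordered a I s w u)) \<partial>?U) \<partial>?L)"
      by (simp add: K_def W' mult_ac)
    also have "\<dots> = (\<integral>\<^sup>+w. ennreal (1 / q ^ p) * (\<integral>\<^sup>+u. (F (bordered a I s w u) *
        gram_weight p D' (insert a I) (bordered a I s w u)) \<partial>?U) \<partial>?L)"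
      by (intro nn_integral_cong nn_integral_cmult) measurable
    also have "\<dots> = ennreal (1 / q ^ p) * (\<integral>\<^sup>+w. (\<integral>\<^sup>+u. (F (bordered a I s w u) *
        gram_weight p D' (insert a I) (bordered a I s w u)) \<partial>?U) \<partial>?L)"
      by (rule nn_integral_cmult) measurable
    finally show ?thesis .
  qed
  finally have main: "(\<integral>\<^sup>+v. F (\<lambda>p\<in>upairs (insert a I). gram (v(a := q *\<^sub>R e)) p) \<partial>PiM I (\<lambda>_. span_lborel (insert e C))) =
    ennreal c * (ennreal (1 / q ^ card I) * (ennreal (1 / q ^ p) * (\<integral>\<^sup>+w. \<integral>\<^sup>+u. F (bordered a I s w u) *
      gram_weight p D' (insert a I) (bordered a I s w u) \<partial>?U \<partial>?L)))" .
  have "ennreal (c / q ^ (card I + p)) = ennreal c * (ennreal (1 / q ^ card I) * ennreal (1 / q ^ p))"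
    using q \<open>c \<ge> 0\<close> by (simp add: power_add flip: ennreal_mult)
  then show ?thesis
    using main by (simp only: mult.assoc flip: q_def)
qed

text \<open>The origin is null because the density of \<open>x \<bullet> x\<close> vanishes for
  \<open>s \<le> 0\<close>.\<close>

lemma AE_span_lborel_nonzero:
  fixes B :: "'a::euclidean_space set"
  assumes "orthonormal B" "card B = Suc (Suc n)"
  shows "AE x in span_lborel B. x \<noteq> 0"
proof -
  have "(\<integral>\<^sup>+x. indicator {..0} (x \<bullet> x) \<partial>span_lborel B) = 0"
    unfolding nn_integral_span_lborel_inner_self[OF assms borel_measurable_indicator, OF atMost_borel]
    by (subst nn_integral_0_iff_AE) (auto simp: indicator_def)
  then have "AE x in span_lborel B. indicator {..0} (x \<bullet> x) = (0::ennreal)"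
    by (subst (asm) nn_integral_0_iff_AE) auto
  then show ?thesis
    by eventually_elim (auto simp: indicator_def)
qed

text \<open>Removing from each vector its component along \<open>v a\<close> subtracts exactly the
  outer product term from the Gram entries. Schur complements of Gram matrices are thus Gram
  matrices of vectors in the same space, which carries the claim on \<open>D\<close> through the
  induction.\<close>

lemma gram_projection:
  assumes "v a \<noteq> 0"
  shows "schur a I (\<lambda>p\<in>upairs (insert a I). gram v p) =
    (\<lambda>p\<in>upairs I. gram (\<lambda>i. v i - ((v i \<bullet> v a) / (v a \<bullet> v a)) *\<^sub>R v a) p)"
proof
  fix p
  have "v a \<bullet> v a \<noteq> 0" using assms by simp
  show "schur a I (\<lambda>p\<in>upairs (insert a I). gram v p) p =
    (\<lambda>p\<in>upairs I. gram (\<lambda>i. v i - ((v i \<bullet> v a) / (v a \<bullet> v a)) *\<^sub>R v a) p) p"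
  proof (cases p)
    case (Upair i j)
    then show ?thesis using \<open>v a \<bullet> v a \<noteq> 0\<close>
      by (simp add: schur_def inner_diff_left inner_diff_right inner_commute field_simps)
  qed
qed

lemma subdet_restrict: "subdet I (\<lambda>p\<in>upairs I. u p) = subdet I u"
  by (rule subdet_cong) simp

text \<open>\<open>D\<close> expresses positivity of the successive pivots. It is existential
  because the order of elimination is that of the finite induction, but one \<open>D\<close> serves
  all \<open>B\<close> and \<open>F\<close>. Its two bounds, that it implies a positive determinant
  and that it contains the nonsingular Gram matrices, suffice to compare it with the image. The
  relation \<open>card B = card I + p + 1\<close> persists with the same \<open>p\<close> when one
  vector and one dimension are removed.\<close>

lemma gram_distribution:
  fixes I :: "'i::finite set"
  shows "\<exists>D. Measurable.pred (PiM (upairs I) (\<lambda>_. lborel)) D \<and> (\<forall>u. D u \<longrightarrow> subdet I u > 0) \<and>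
    (\<forall>v::'i \<Rightarrow> 'a::euclidean_space. subdet I (gram v) \<noteq> 0 \<longrightarrow> D (\<lambda>p\<in>upairs I. gram v p)) \<and>
    (\<forall>B::'a set. \<forall>F. orthonormal B \<longrightarrow> card B = card I + p + 1 \<longrightarrow>
      F \<in> borel_measurable (PiM (upairs I) (\<lambda>_. lborel)) \<longrightarrow>
      (\<integral>\<^sup>+v. F (\<lambda>p\<in>upairs I. gram v p) \<partial>PiM I (\<lambda>_. span_lborel B)) =
      ennreal (gram_const p (card I)) * (\<integral>\<^sup>+u. F u * gram_weight p D I u \<partial>PiM (upairs I) (\<lambda>_. lborel)))"
  using finite[of I]
proof (induction I rule: finite_induct)
  case empty
  \<comment> \<open>Without vectors both product measures are point masses, the determinant is that
    of the identity, and the constant is an empty product.\<close>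
  have "subdet {} u = 1" for u :: "'i uprod \<Rightarrow> real"
    using det_I[where 'n = 'i] by (simp add: subdet_def mat_def)
  then show ?case
    by (intro exI[of _ "\<lambda>_. True"])
      (auto simp: gram_const_def gram_weight_def PiM_empty nn_integral_count_space_finite restrict_def)
next
  case (insert a I)
  then obtain D where D[measurable]: "Measurable.pred (PiM (upairs I) (\<lambda>_. lborel)) D"
    and D_pos: "\<And>u. D u \<Longrightarrow> subdet I u > 0"
    and D_gram: "\<And>v::'i \<Rightarrow> 'a. subdet I (gram v) \<noteq> 0 \<Longrightarrow> D (\<lambda>p\<in>upairs I. gram v p)"
    and IH: "\<And>(B::'a set) F. orthonormal B \<Longrightarrow> card B = card I + p + 1 \<Longrightarrow>
      F \<in> borel_measurable (PiM (upairs I) (\<lambda>_. lborel)) \<Longrightarrow>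
      (\<integral>\<^sup>+v. F (\<lambda>p\<in>upairs I. gram v p) \<partial>PiM I (\<lambda>_. span_lborel B)) =
      ennreal (gram_const p (card I)) * (\<integral>\<^sup>+u. F u * gram_weight p D I u \<partial>PiM (upairs I) (\<lambda>_. lborel))"
    by blast
  note a = \<open>a \<notin> I\<close>
  define D' where "D' u \<longleftrightarrow> u (Upair a a) > 0 \<and> D (schur a I u)" for u
  have aa: "(\<lambda>u. u (Upair a a)) \<in> borel_measurable (PiM (upairs (insert a I)) (\<lambda>_. lborel))"
    using measurable_component_singleton[of "Upair a a" "upairs (insert a I)" "\<lambda>_. lborel"] by simp
  have D'[measurable]: "Measurable.pred (PiM (upairs (insert a I)) (\<lambda>_. lborel)) D'"
    unfolding D'_def by measurable
  have "subdet (insert a I) u > 0" if "D' u" for u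
    using subdet_insert[OF a, of u] D_pos[of "schur a I u"] that by (simp add: D'_def)
  moreover have "D' (\<lambda>p\<in>upairs (insert a I). gram v p)" if ne: "subdet (insert a I) (gram v) \<noteq> 0" for v :: "'i \<Rightarrow> 'a"
  proof -
    have "v a \<noteq> 0"
      using ne subdet_eq_0_zero_row[of a "insert a I" "gram v"] by auto
    moreover have "D (schur a I (\<lambda>p\<in>upairs (insert a I). gram v p))"
      unfolding gram_projection[of v a, OF \<open>v a \<noteq> 0\<close>]
    proof (rule D_gram)
      have "subdet (insert a I) (\<lambda>p\<in>upairs (insert a I). gram v p) \<noteq> 0"
        using ne by (simp add: subdet_restrict)
      then have "subdet I (schur a I (\<lambda>p\<in>upairs (insert a I). gram v p)) \<noteq> 0"
        using subdet_insert[OF a, of "\<lambda>p\<in>upairs (insert a I). gram v p"] \<open>v a \<noteq> 0\<close> by auto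
      then show "subdet I (gram (\<lambda>i. v i - ((v i \<bullet> v a) / (v a \<bullet> v a)) *\<^sub>R v a)) \<noteq> 0"
        unfolding gram_projection[of v a, OF \<open>v a \<noteq> 0\<close>] by (simp add: subdet_restrict)
    qed
    ultimately show ?thesis by (simp add: D'_def)
  qed
  moreover have "(\<integral>\<^sup>+v. F (\<lambda>p\<in>upairs (insert a I). gram v p) \<partial>PiM (insert a I) (\<lambda>_. span_lborel B)) =
      ennreal (gram_const p (card (insert a I))) *
      (\<integral>\<^sup>+u. F u * gram_weight p D' (insert a I) u \<partial>PiM (upairs (insert a I)) (\<lambda>_. lborel))"
    if B: "orthonormal B" "card B = card (insert a I) + p + 1"
      and F[measurable]: "F \<in> borel_measurable (PiM (upairs (insert a I)) (\<lambda>_. lborel))" for B :: "'a set" and F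
  proof -
    let ?L = "PiM I (\<lambda>_. lborel :: real measure)"
    let ?U = "PiM (upairs I) (\<lambda>_. lborel :: real measure)"
    let ?c = "gram_const p (card I)"
    \<comment> \<open>In dimension \<open>n + 2\<close> the radial density contains
      \<open>sqrt s ^ n\<close>, the very power by which \<open>gram_vector_decomposition\<close>
      divides.\<close>
    define n where "n = card I + p"
    have cardB: "card B = Suc (Suc n)" using B a insert.hyps by (simp add: n_def)
    have sfB: "sigma_finite_measure (span_lborel B)" by (rule sigma_finite_span_lborel[OF B(1)])
    interpret B: product_sigma_finite "\<lambda>_::'i. span_lborel B" by (rule product_sigma_finite_const[OF sfB])
    interpret U: product_sigma_finite "\<lambda>_::'i uprod. lborel :: real measure" by (rule product_sigma_finite_lborel)
    interpret U: sigma_finite_measure ?U by (rule U.sigma_finite) simp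
    interpret L: product_sigma_finite "\<lambda>_::'i. lborel :: real measure" by (rule product_sigma_finite_lborel)
    interpret L: sigma_finite_measure ?L by (rule L.sigma_finite) simp
    define K where "K s = (\<integral>\<^sup>+w. \<integral>\<^sup>+u. F (bordered a I s w u) *
      gram_weight p D' (insert a I) (bordered a I s w u) \<partial>?U \<partial>?L)" for s
    have [measurable]: "K \<in> borel_measurable borel" unfolding K_def by measurable
    have "(\<integral>\<^sup>+v. F (\<lambda>p\<in>upairs (insert a I). gram v p) \<partial>PiM (insert a I) (\<lambda>_. span_lborel B)) =
        (\<integral>\<^sup>+x. \<integral>\<^sup>+v. F (\<lambda>p\<in>upairs (insert a I). gram (v(a := x)) p) \<partial>PiM I (\<lambda>_. span_lborel B) \<partial>span_lborel B)"
    proof (rule B.product_nn_integral_insert_rev)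
      have "(\<lambda>v. v i) \<in> borel_measurable (PiM (insert a I) (\<lambda>_. span_lborel B))" if "i \<in> insert a I" for i
        using measurable_component_singleton[OF that, of "\<lambda>_. span_lborel B"] by (simp cong: measurable_cong_sets)
      then show "(\<lambda>v. F (\<lambda>p\<in>upairs (insert a I). gram v p)) \<in> borel_measurable (PiM (insert a I) (\<lambda>_. span_lborel B))"
        by (intro measurable_compose[OF _ F] measurable_gram)
    qed (use a in auto)
    also have "\<dots> = (\<integral>\<^sup>+x. (\<lambda>s. ennreal (?c / sqrt s ^ n) * K s) (x \<bullet> x) \<partial>span_lborel B)"
    proof (rule nn_integral_cong_AE)
      show "AE x in span_lborel B. (\<integral>\<^sup>+v. F (\<lambda>p\<in>upairs (insert a I). gram (v(a := x)) p) \<partial>PiM I (\<lambda>_. span_lborel B)) =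
          (\<lambda>s. ennreal (?c / sqrt s ^ n) * K s) (x \<bullet> x)"
        using AE_span_lborel[of B] AE_span_lborel_nonzero[OF B(1) cardB]
      proof eventually_elim
        case (elim x)
        define e where "e = (1 / norm x) *\<^sub>R x"
        have e: "e \<in> span B" "e \<bullet> e = 1"
          using elim by (auto simp: e_def span_scale power2_norm_eq_inner[symmetric] power2_eq_square)
        have x: "x = sqrt (x \<bullet> x) *\<^sub>R e" using elim by (simp add: e_def norm_eq_sqrt_inner)
        \<comment> \<open>\<open>C\<close> depends on \<open>x\<close>, so the inner integral is
          evaluated for each \<open>x\<close> separately; the result involves \<open>x\<close> only
          through \<open>x \<bullet> x\<close>.\<close>
        obtain C where C: "orthonormal C" "e \<notin> C" "\<And>x. x \<in> span C \<Longrightarrow> x \<bullet> e = 0" "Suc (card C) = card B"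
          "span_lborel B = span_lborel (insert e C)"
          using orthonormal_insert_unit[OF B(1) e] by metis
        have "(\<integral>\<^sup>+v. F (\<lambda>p\<in>upairs (insert a I). gram (v(a := sqrt (x \<bullet> x) *\<^sub>R e)) p) \<partial>PiM I (\<lambda>_. span_lborel (insert e C))) =
           ennreal (?c / sqrt (x \<bullet> x) ^ (card I + p)) * K (x \<bullet> x)"
          unfolding K_def
        proof (rule gram_vector_decomposition[OF C(1,2) e(2) C(3) a _ D _ F _ D'_def])
          show "x \<bullet> x > 0" using elim by simp
          show "0 \<le> ?c" using gram_const_pos[of p "card I"] by simp
          show "(\<integral>\<^sup>+v. F (\<lambda>p\<in>upairs I. gram v p) \<partial>PiM I (\<lambda>_. span_lborel C)) =
              ennreal ?c * (\<integral>\<^sup>+u. F u * gram_weight p D I u \<partial>?U)" if "F \<in> borel_measurable ?U" for F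
            using that C cardB by (intro IH) (auto simp: n_def)
        qed
        then show ?case
          unfolding C(5) n_def x[symmetric] .
      qed
    qed
    also have "\<dots> = (\<integral>\<^sup>+s. (ennreal (?c / sqrt s ^ n) * K s) * ennreal (sphere_vol (Suc n) / 2 * (if s > 0 then sqrt s ^ n else 0)) \<partial>lborel)"
      by (rule nn_integral_span_lborel_inner_self[OF B(1) cardB]) measurable
    also have "\<dots> = (\<integral>\<^sup>+s. ennreal (?c * (sphere_vol (Suc n) / 2)) * K s \<partial>lborel)"
    proof (rule nn_integral_cong)
      fix s :: real
      show "(ennreal (?c / sqrt s ^ n) * K s) * ennreal (sphere_vol (Suc n) / 2 * (if s > 0 then sqrt s ^ n else 0)) =
        ennreal (?c * (sphere_vol (Suc n) / 2)) * K s"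
      proof (cases "s > 0")
        case True
        have "ennreal (?c / sqrt s ^ n) * ennreal (sphere_vol (Suc n) / 2 * sqrt s ^ n) =
            ennreal (?c * (sphere_vol (Suc n) / 2))"
          using True gram_const_pos[of p "card I"] sphere_vol_pos[of "Suc n"]
          by (simp flip: ennreal_mult)
        then show ?thesis
          using True by (simp add: mult_ac)
      next
        case False
        \<comment> \<open>For \<open>s \<le> 0\<close> the two powers do not cancel, but a bordered
          matrix with such a corner violates \<open>D'\<close>.\<close>
        then have "K s = 0"
          using a by (simp add: K_def gram_weight_def D'_def bordered_simps)
        then show ?thesis by simp
      qed
    qed
    also have "\<dots> = ennreal (?c * (sphere_vol (Suc n) / 2)) * (\<integral>\<^sup>+s. K s \<partial>lborel)"
      by (rule nn_integral_cmult) measurable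
    also have "(\<integral>\<^sup>+s. K s \<partial>lborel) =
       (\<integral>\<^sup>+u. F u * gram_weight p D' (insert a I) u \<partial>PiM (upairs (insert a I)) (\<lambda>_. lborel))"
      unfolding K_def by (rule nn_integral_bordered[symmetric, OF a]) (simp, simp, measurable)
    \<comment> \<open>\<open>Suc n = p + card (insert a I)\<close>, so this is the next factor of
      the product.\<close>
    also have "?c * (sphere_vol (Suc n) / 2) = gram_const p (card (insert a I))"
      using a by (simp add: gram_const_def n_def add.commute)
    finally show ?thesis .
  qed
  ultimately show ?case
    using D' by (intro exI[of _ D']) blast
qed

subsection \<open>The push-forward under the Hilbert embedding\<close>

lemma measurable_vec_lambda:
  "(\<lambda>f. \<chi> i. f i) \<in> PiM UNIV (\<lambda>_::'n::finite. lborel) \<rightarrow>\<^sub>M (borel :: ('a::euclidean_space ^ 'n) measure)"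
proof (rule borel_measurable_euclidean_space[THEN iffD2], intro ballI)
  fix B :: "'a ^ 'n" assume "B \<in> Basis"
  then obtain i b where "B = axis i b" by (auto simp: Basis_vec_def)
  then have "(\<lambda>f. (\<chi> i. f i) \<bullet> B) = (\<lambda>f. f i \<bullet> b)" by (simp add: inner_axis)
  moreover have "(\<lambda>f. f i \<bullet> b) \<in> borel_measurable (PiM UNIV (\<lambda>_::'n. lborel :: 'a measure))"
    using measurable_component_singleton[of i UNIV "\<lambda>_. lborel"] by simp
  ultimately show "(\<lambda>f. (\<chi> i. f i) \<bullet> B) \<in> borel_measurable (PiM UNIV (\<lambda>_::'n. lborel :: 'a measure))"
    by simp
qed

text \<open>Needed both for the tuple of vectors and for the Gram coordinates. The volumes of boxes
  agree because the basis of \<open>'a ^ 'n\<close> consists of the vectors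
  \<open>axis i b\<close>.\<close>

lemma lborel_vec_eq:
  "(lborel :: ('a::euclidean_space ^ 'n::finite) measure) =
    distr (PiM UNIV (\<lambda>_. lborel)) borel (\<lambda>f. \<chi> i. f i)"
proof (rule lborel_eqI)
  interpret product_sigma_finite "\<lambda>_::'n. lborel :: 'a measure"
    by (rule product_sigma_finite_lborel)
  note m = measurable_vec_lambda[where 'a = 'a and 'n = 'n]
  fix l u :: "'a ^ 'n" assume lu: "\<And>b. b \<in> Basis \<Longrightarrow> l \<bullet> b \<le> u \<bullet> b"
  have le: "l $ i \<bullet> b \<le> u $ i \<bullet> b" if "b \<in> Basis" for i b
    using lu[of "axis i b"] that by (auto simp: inner_axis Basis_vec_def)
  have box: "(\<lambda>f. \<chi> i. f i) -` box l u \<inter> space (PiM UNIV (\<lambda>_::'n. lborel)) = (\<Pi>\<^sub>E i\<in>UNIV. box (l $ i) (u $ i))"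
    by (auto simp: space_PiM box_def Basis_vec_def inner_axis)
  have "emeasure (distr (PiM UNIV (\<lambda>_. lborel)) borel (\<lambda>f. \<chi> i. f i)) (box l u) =
     emeasure (PiM UNIV (\<lambda>_::'n. lborel)) (\<Pi>\<^sub>E i\<in>UNIV. box (l $ i) (u $ i))"
    using m by (simp add: emeasure_distr box)
  also have "\<dots> = (\<Prod>i\<in>UNIV. ennreal (\<Prod>b\<in>Basis. (u $ i - l $ i) \<bullet> b))"
    using le by (subst emeasure_PiM) (auto simp: emeasure_lborel_box)
  also have "\<dots> = ennreal (\<Prod>i\<in>UNIV. \<Prod>b\<in>Basis. (u $ i - l $ i) \<bullet> b)"
    using le by (intro prod_ennreal prod_nonneg) (simp add: inner_diff_left)
  also have "(\<Prod>i\<in>UNIV. \<Prod>b\<in>Basis. (u $ i - l $ i) \<bullet> b) = (\<Prod>(i, b)\<in>UNIV \<times> Basis. (u - l) \<bullet> axis i b)"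
    by (simp add: prod.cartesian_product inner_axis)
  also have "\<dots> = prod ((\<bullet>) (u - l)) ((\<lambda>(i, b). axis i b) ` (UNIV \<times> Basis))"
    by (subst prod.reindex) (auto simp: inj_on_def axis_eq_axis nonzero_Basis split_beta')
  also have "(\<lambda>(i, b). axis i b) ` (UNIV \<times> Basis) = (Basis :: ('a ^ 'n) set)"
    by (auto simp: Basis_vec_def)
  finally show "emeasure (distr (PiM UNIV (\<lambda>_. lborel)) borel (\<lambda>f. \<chi> i. f i)) (box l u) = ennreal (prod ((\<bullet>) (u - l)) Basis)" .
qed simp

lemma nn_integral_lborel_vec:
  fixes f :: "'a::euclidean_space ^ 'n::finite \<Rightarrow> ennreal"
  assumes "f \<in> borel_measurable borel"
  shows "(\<integral>\<^sup>+x. f x \<partial>lborel) = (\<integral>\<^sup>+g. f (\<chi> i. g i) \<partial>PiM UNIV (\<lambda>_. lborel))"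
  by (subst lborel_vec_eq) (simp add: nn_integral_distr measurable_vec_lambda assms)

lemma continuous_hilbert_map: "continuous_on UNIV (hilbert_map :: real^'m::finite^'k::finite \<Rightarrow> _)"
proof -
  have "continuous_on UNIV (\<lambda>v :: real^'m^'k. hilbert_map v $ p)" for p
    by (cases p) (simp, intro continuous_intros)
  then have "continuous_on UNIV (\<lambda>v :: real^'m^'k. \<chi> p. hilbert_map v $ p)"
    by (intro continuous_on_vec_lambda)
  then show ?thesis by (simp add: vec_lambda_eta)
qed

lemma measurable_hilbert_map [measurable]: "hilbert_map \<in> borel_measurable borel"
  using continuous_hilbert_map by (rule borel_measurable_continuous_onI)

text \<open>A continuous image of a Borel set need not be Borel; exhausting the domain by balls
  makes this one a countable union of compact sets.\<close>

lemma measurable_hilbert_image [measurable]: "hilbert_image TYPE('m::finite) \<in> sets borel"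
proof -
  have "hilbert_image TYPE('m) = (\<Union>n. hilbert_map ` cball (0 :: real^'m^'k) (real n))"
    unfolding hilbert_image_def image_UN[symmetric]
    by (rule arg_cong[where f = "image _"]) (auto simp: real_arch_simple)
  also have "\<dots> \<in> sets borel"
  proof (rule sets.countable_UN, safe)
    fix n :: nat
    have "compact (hilbert_map ` cball (0 :: real^'m^'k) (real n))"
      by (intro compact_continuous_image continuous_on_subset[OF continuous_hilbert_map]) auto
    then show "hilbert_map ` cball (0 :: real^'m^'k) (real n) \<in> sets borel"
      by (rule borel_compact)
  qed
  finally show ?thesis .
qed

section \<open>The zero set of the Gram determinant\<close>

lemma det_gram_matrix: "det (gram_matrix z) = subdet UNIV (\<lambda>p. z $ p)"
  by (simp add: subdet_def gram_matrix_def)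

lemma measurable_det_gram [measurable]:
  "(\<lambda>z :: real^('k::finite uprod). det (gram_matrix z)) \<in> borel_measurable borel"
  unfolding gram_matrix_def det_def vec_lambda_beta
  by (intro borel_measurable_sum borel_measurable_times borel_measurable_prod borel_measurable_const)
     (intro borel_measurable_continuous_onI continuous_intros)

text \<open>Each such \<open>-t\<close> is an eigenvalue of \<open>A\<close>. Eigenvectors of a
  symmetric matrix for distinct eigenvalues are orthogonal, hence independent, hence finite in
  number.\<close>

lemma finite_singular_shifts:
  fixes A :: "real^'n::finite^'n"
  assumes sym: "transpose A = A"
  shows "finite {t. det (A + t *\<^sub>R mat 1) = 0}" (is "finite ?T")
proof -
  have "\<exists>x. x \<noteq> 0 \<and> A *v x = - (t *\<^sub>R x)" if "t \<in> ?T" for t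
  proof -
    have "\<not> inj ((*v) (A + t *\<^sub>R mat 1))"
      using that det_nz_iff_inj[of "(*v) (A + t *\<^sub>R mat 1)"] by simp
    then obtain x y where "x \<noteq> y" "(A + t *\<^sub>R mat 1) *v x = (A + t *\<^sub>R mat 1) *v y"
      by (auto simp: inj_def)
    then have "x - y \<noteq> 0" "(A + t *\<^sub>R mat 1) *v (x - y) = 0"
      by (auto simp: matrix_vector_mult_diff_distrib)
    moreover have "(t *\<^sub>R mat 1) *v (x - y) = t *\<^sub>R (x - y)"
      by (simp add: scaleR_matrix_vector_assoc[symmetric])
    ultimately show ?thesis
      by (intro exI[of _ "x - y"]) (simp add: matrix_vector_mult_add_rdistrib eq_neg_iff_add_eq_0)
  qed
  then obtain e where e: "\<And>t. t \<in> ?T \<Longrightarrow> e t \<noteq> 0" "\<And>t. t \<in> ?T \<Longrightarrow> A *v e t = - (t *\<^sub>R e t)"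
    by metis
  have orth: "e s \<bullet> e t = 0" if "s \<in> ?T" "t \<in> ?T" "s \<noteq> t" for s t
  proof -
    have "(A *v e s) \<bullet> e t = e s \<bullet> (A *v e t)"
      using dot_lmul_matrix[of "e s" A "e t"] transpose_matrix_vector[of A "e s"] sym by simp
    then have "s * (e s \<bullet> e t) = t * (e s \<bullet> e t)"
      using e(2)[OF that(1)] e(2)[OF that(2)] by simp
    then show ?thesis using that by simp
  qed
  have "inj_on e ?T"
    using orth e(1) by (metis (no_types, lifting) inj_onI inner_eq_zero_iff)
  moreover have "pairwise orthogonal (e ` ?T)"
    using orth by (auto simp: pairwise_def orthogonal_def)
  then have "independent (e ` ?T)"
    using e(1) by (intro pairwise_orthogonal_independent) auto
  then have "finite (e ` ?T)"
    by (rule independent_imp_finite)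
  ultimately show ?thesis
    by (metis finite_imageD)
qed

text \<open>The lines parallel to the diagonal meet the zero set of the determinant in finitely many points.\<close>

lemma AE_det_gram_nonzero: "AE z in lborel. det (gram_matrix (z :: real^('k::finite uprod))) \<noteq> 0"
proof -
  define N where "N = {z :: real^('k uprod). det (gram_matrix z) = 0}"
  \<comment> \<open>\<open>d\<close> is the identity matrix in Gram coordinates: the pairs that are
    not proper are the diagonal ones.\<close>
  define d :: "real^('k uprod)" where "d = (\<chi> p. if proper_uprod p then 0 else 1)"
  have [measurable]: "N \<in> sets borel" unfolding N_def by measurable
  have gram_shift: "gram_matrix (z + t *\<^sub>R d) = gram_matrix z + t *\<^sub>R mat 1" for z :: "real^('k uprod)" and t
    by (simp add: gram_matrix_def d_def vec_eq_iff mat_def)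
  \<comment> \<open>Averaging over the unit interval introduces the line parameter \<open>t\<close>;
    translation invariance turns the constant into the mass of shifted copies of \<open>N\<close>,
    and Tonelli then integrates along each line first.\<close>
  have "emeasure lborel N = (\<integral>\<^sup>+t. indicator {0..1} t * emeasure lborel N \<partial>(lborel :: real measure))"
    by (simp add: nn_integral_multc)
  also have "\<dots> = (\<integral>\<^sup>+t. \<integral>\<^sup>+z. indicator {0..1} t * indicator N (z + t *\<^sub>R d) \<partial>lborel \<partial>(lborel :: real measure))"
  proof (rule nn_integral_cong)
    fix t :: real
    have "(\<integral>\<^sup>+z. indicator N z \<partial>distr lborel borel ((+) (t *\<^sub>R d))) = (\<integral>\<^sup>+z. indicator N (t *\<^sub>R d + z) \<partial>lborel)"
      by (rule nn_integral_distr) measurable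
    then have "emeasure lborel N = (\<integral>\<^sup>+z. indicator N (z + t *\<^sub>R d) \<partial>lborel)"
      by (simp add: lborel_distr_plus add.commute)
    then show "indicator {0..1} t * emeasure lborel N = (\<integral>\<^sup>+z. indicator {0..1} t * indicator N (z + t *\<^sub>R d) \<partial>lborel)"
      by (simp add: nn_integral_cmult)
  qed
  also have "\<dots> = (\<integral>\<^sup>+z. \<integral>\<^sup>+t. indicator {0..1} t * indicator N (z + t *\<^sub>R d) \<partial>(lborel :: real measure) \<partial>lborel)"
    by (rule lborel_pair.Fubini') measurable
  also have "\<dots> = (\<integral>\<^sup>+z. 0 \<partial>(lborel :: (real^('k uprod)) measure))"
  proof (rule nn_integral_cong)
    fix z :: "real^('k uprod)"
    have "transpose (gram_matrix z) = gram_matrix z"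
      by (simp add: gram_matrix_def transpose_def vec_eq_iff) (metis Upair_inject)
    then have "finite {t. z + t *\<^sub>R d \<in> N}"
      unfolding N_def mem_Collect_eq gram_shift by (rule finite_singular_shifts)
    then have "AE t in lborel. t \<notin> {t. z + t *\<^sub>R d \<in> N}"
      by (intro AE_not_in finite_imp_null_set_lborel)
    then have "AE t in lborel. indicator {0..1} t * indicator N (z + t *\<^sub>R d) = (0::ennreal)"
      by eventually_elim (simp add: indicator_def)
    then show "(\<integral>\<^sup>+t. indicator {0..1} t * indicator N (z + t *\<^sub>R d) \<partial>(lborel :: real measure)) = 0"
      by (subst nn_integral_0_iff_AE) auto
  qed
  finally have "N \<in> null_sets lborel" by auto
  then show ?thesis using AE_not_in by (force simp: N_def)
qed

section \<open>From the pivot region to the image of the Hilbert map\<close>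

definition hilbert_density :: "'m::finite itself \<Rightarrow> real^('k::finite uprod) \<Rightarrow> real" where
  "hilbert_density T u = gram_power T u / 2 ^ CARD('k) * (\<Prod>j=1..CARD('k). sphere_vol (CARD('m) - j))"

text \<open>The reversal \<open>q = k + 1 - j\<close> turns \<open>m - j\<close> into
  \<open>p + q\<close>.\<close>

lemma hilbert_density_eq_gram_const:
  assumes "CARD('k::finite) < CARD('m::finite)"
  defines "p \<equiv> CARD('m) - CARD('k) - 1"
  shows "hilbert_density TYPE('m) (u :: real^('k uprod)) = gram_const p CARD('k) * sqrt (det (gram_matrix u)) ^ p"
proof -
  have "(\<Prod>j=1..CARD('k). sphere_vol (CARD('m) - j)) = (\<Prod>q=1..CARD('k). sphere_vol (p + q))"
    by (rule prod.reindex_bij_witness[of _ "\<lambda>q. CARD('k) + 1 - q" "\<lambda>j. CARD('k) + 1 - j"])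
       (use assms in auto)
  then show ?thesis
    by (simp add: hilbert_density_def gram_const_def prod_dividef gram_power_def p_def)
qed

text \<open>Here \<open>D\<close> is exchanged for the image: off the image the weight vanishes
  almost everywhere, on it a nonzero determinant gives \<open>D\<close>, and the zero set of the
  determinant is null. The sign of the determinant on the image follows from the same bounds on
  \<open>D\<close>.\<close>

lemma hilbert_map_distribution:
  assumes km: "CARD('k::finite) < CARD('m::finite)"
  shows "(\<forall>u \<in> hilbert_image TYPE('m). 0 \<le> det (gram_matrix (u :: real^('k uprod)))) \<and>
    (\<forall>G \<in> borel_measurable borel. (\<integral>\<^sup>+v. G (hilbert_map (v :: real^'m^'k)) \<partial>lborel) =
    (\<integral>\<^sup>+u. G u * (ennreal (hilbert_density TYPE('m) u) * indicator (hilbert_image TYPE('m)) u) \<partial>lborel))"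
proof -
  define p where "p = CARD('m) - CARD('k) - 1"
  let ?c = "gram_const p CARD('k)"
  let ?W = "hilbert_image TYPE('m) :: (real^('k uprod)) set"
  obtain D where D[measurable]: "Measurable.pred (PiM (upairs UNIV) (\<lambda>_. lborel)) (D :: ('k uprod \<Rightarrow> real) \<Rightarrow> bool)"
    and D_pos: "\<And>u. D u \<Longrightarrow> subdet UNIV u > 0"
    and D_gram: "\<And>v::'k \<Rightarrow> real^'m. subdet UNIV (gram v) \<noteq> 0 \<Longrightarrow> D (\<lambda>p\<in>upairs UNIV. gram v p)"
    and dist: "\<And>(B::(real^'m) set) F. orthonormal B \<Longrightarrow> card B = card (UNIV :: 'k set) + p + 1 \<Longrightarrow>
      F \<in> borel_measurable (PiM (upairs UNIV) (\<lambda>_. lborel)) \<Longrightarrow>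
      (\<integral>\<^sup>+v. F (\<lambda>p\<in>upairs UNIV. gram v p) \<partial>PiM UNIV (\<lambda>_. span_lborel B)) =
      ennreal ?c * (\<integral>\<^sup>+u. F u * gram_weight p D UNIV u \<partial>PiM (upairs UNIV) (\<lambda>_. lborel))"
    using gram_distribution[where I = "UNIV :: 'k set" and 'a = "real^'m" and p = p] by blast
  define w where "w z = gram_weight p D UNIV (\<lambda>p. z $ p)" for z :: "real^('k uprod)"
  have hm: "hilbert_map v = (\<chi> p. gram (\<lambda>i. v $ i) p)" for v :: "real^'m^'k"
    unfolding vec_eq_iff
  proof
    fix p :: "'k uprod" show "hilbert_map v $ p = (\<chi> p. gram (\<lambda>i. v $ i) p) $ p" by (cases p) simp
  qed
  have nth: "(\<lambda>z p. z $ p) \<in> borel \<rightarrow>\<^sub>M PiM UNIV (\<lambda>_::'k uprod. lborel :: real measure)"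
    by (rule measurable_PiM_single') auto
  have [measurable]: "w \<in> borel_measurable borel"
    unfolding w_def using measurable_compose[OF nth, of "gram_weight p D UNIV" borel] measurable_gram_weight[OF D] by simp
  have push: "(\<integral>\<^sup>+v. G (hilbert_map (v :: real^'m^'k)) \<partial>lborel) = ennreal ?c * (\<integral>\<^sup>+z. G z * w z \<partial>lborel)"
    if [measurable]: "G \<in> borel_measurable borel" for G
  proof -
    have "(\<integral>\<^sup>+v. G (hilbert_map (v :: real^'m^'k)) \<partial>lborel) =
        (\<integral>\<^sup>+v. G (hilbert_map (\<chi> i. (v i :: real^'m))) \<partial>PiM UNIV (\<lambda>_::'k. lborel))"
      by (rule nn_integral_lborel_vec) measurable
    also have "\<dots> =
        (\<integral>\<^sup>+v. G (\<chi> p. (\<lambda>p\<in>upairs UNIV. gram v p) p) \<partial>PiM UNIV (\<lambda>_::'k. span_lborel (Basis :: (real^'m) set)))"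
      by (simp add: hm span_lborel_Basis restrict_UNIV)
    also have "\<dots> = ennreal ?c * (\<integral>\<^sup>+u. G (\<chi> p. u p) * gram_weight p D UNIV u \<partial>PiM (upairs UNIV) (\<lambda>_. lborel))"
      using km measurable_compose[OF measurable_vec_lambda that]
      by (intro dist orthonormal_Basis) (auto simp: p_def)
    also have "(\<integral>\<^sup>+u. G (\<chi> p. u p) * gram_weight p D UNIV u \<partial>PiM (upairs UNIV) (\<lambda>_. lborel)) = (\<integral>\<^sup>+z. G z * w z \<partial>lborel)"
    proof -
      have "(\<integral>\<^sup>+z. G z * w z \<partial>lborel) = (\<integral>\<^sup>+u. G (\<chi> p. u p) * w (\<chi> p. u p) \<partial>PiM UNIV (\<lambda>_. lborel))"
        by (rule nn_integral_lborel_vec) measurable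
      then show ?thesis by (simp add: w_def)
    qed
    finally show ?thesis .
  qed
  have D_image: "D (\<lambda>p. z $ p)" if zW: "z \<in> ?W" and "det (gram_matrix z) \<noteq> 0" for z :: "real^('k uprod)"
  proof -
    obtain v :: "real^'m^'k" where z: "z = hilbert_map v" using zW by (auto simp: hilbert_image_def)
    then show ?thesis using D_gram[of "\<lambda>i. v $ i"] that by (simp add: det_gram_matrix hm restrict_UNIV)
  qed
  have nonneg: "0 \<le> det (gram_matrix z)" if "z \<in> ?W" for z
    using D_pos[OF D_image[OF that]] by (cases "det (gram_matrix z) = 0") (simp_all add: det_gram_matrix)
  \<comment> \<open>The push-forward formula is tested on the complement of the image, which the map
    never enters; the constant is positive, so the weight must vanish there.\<close>
  have "(\<integral>\<^sup>+z. indicator (- ?W) z * w z \<partial>lborel) = 0"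
  proof -
    have "(indicator (- ?W) :: _ \<Rightarrow> ennreal) \<in> borel_measurable borel"
      by (intro borel_measurable_indicator) (simp add: measurable_hilbert_image)
    note push[OF this]
    moreover have "indicator (- ?W) (hilbert_map v) = (0 :: ennreal)" for v :: "real^'m^'k"
      by (simp add: hilbert_image_def)
    ultimately show ?thesis using gram_const_pos[of p "CARD('k)"] by simp
  qed
  then have AE0: "AE z in lborel. indicator (- ?W) z * w z = 0"
    by (subst (asm) nn_integral_0_iff_AE) (auto simp: measurable_hilbert_image)
  have dens: "hilbert_density TYPE('m) z = ?c * sqrt (det (gram_matrix z)) ^ p" for z :: "real^('k uprod)"
    using hilbert_density_eq_gram_const[OF km] by (simp add: p_def)
  have AE: "AE z in lborel. ennreal ?c * w z = ennreal (hilbert_density TYPE('m) z) * indicator ?W z"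
    using AE0 AE_det_gram_nonzero
  proof eventually_elim
    case (elim z)
    show ?case
    proof (cases "z \<in> ?W")
      case True
      then show ?thesis
        using D_image[OF True elim(2)] gram_const_pos[of p "CARD('k)"] nonneg[OF True]
        by (simp add: w_def gram_weight_def dens det_gram_matrix flip: ennreal_mult)
    qed (use elim in auto)
  qed
  have "(\<integral>\<^sup>+v. G (hilbert_map (v :: real^'m^'k)) \<partial>lborel) =
    (\<integral>\<^sup>+u. G u * (ennreal (hilbert_density TYPE('m) u) * indicator ?W u) \<partial>lborel)"
    if [measurable]: "G \<in> borel_measurable borel" for G
  proof -
    have "(\<integral>\<^sup>+v. G (hilbert_map (v :: real^'m^'k)) \<partial>lborel) = (\<integral>\<^sup>+z. ennreal ?c * (G z * w z) \<partial>lborel)"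
      by (simp add: push nn_integral_cmult)
    also have "\<dots> = (\<integral>\<^sup>+u. G u * (ennreal (hilbert_density TYPE('m) u) * indicator ?W u) \<partial>lborel)"
      by (rule nn_integral_cong_AE, use AE in eventually_elim) (simp add: mult.left_commute)
    finally show ?thesis .
  qed
  with nonneg show ?thesis by blast
qed

subsection \<open>Smooth functions of compact support\<close>

text \<open>Derivatives are unique, so any explicit one may stand for
  \<open>frechet_derivative\<close>.\<close>

lemma n_times_cont_diff_SucI:
  assumes "\<And>x. (f has_derivative D x) (at x)" "\<And>b. b \<in> Basis \<Longrightarrow> n_times_cont_diff n (\<lambda>x. D x b)"
  shows "n_times_cont_diff (Suc n) f"
proof -
  have "frechet_derivative f (at x) = D x" for x
    using frechet_derivative_at[OF assms(1)] by simp
  then show ?thesis using assms by (auto simp: differentiable_def)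
qed

lemma n_times_cont_diff_has_derivative:
  "n_times_cont_diff (Suc n) f \<Longrightarrow> (f has_derivative frechet_derivative f (at x)) (at x)"
  by (simp add: frechet_derivative_works)

lemma n_times_cont_diff_SucD: "n_times_cont_diff (Suc n) f \<Longrightarrow> n_times_cont_diff n f"
proof (induction n arbitrary: f)
  case 0
  then show ?case
    by (auto intro!: continuous_at_imp_continuous_on differentiable_imp_continuous_within)
qed simp

lemma n_times_cont_diff_const [simp]: "n_times_cont_diff n (\<lambda>_. c)"
proof (induction n arbitrary: c)
  case (Suc n)
  show ?case by (rule n_times_cont_diff_SucI[where D = "\<lambda>_ _. 0"]) (use Suc in auto)
qed simp

lemma n_times_cont_diff_linear:
  assumes "bounded_linear f"
  shows "n_times_cont_diff n f"
proof (cases n)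
  case 0
  then show ?thesis using assms by (simp add: linear_continuous_on)
next
  case (Suc m)
  then show ?thesis
    using n_times_cont_diff_SucI[of f "\<lambda>_. f" m] assms by (simp add: bounded_linear_imp_has_derivative)
qed

lemma n_times_cont_diff_add:
  "n_times_cont_diff n f \<Longrightarrow> n_times_cont_diff n g \<Longrightarrow> n_times_cont_diff n (\<lambda>x. f x + g x)"
proof (induction n arbitrary: f g)
  case (Suc n)
  show ?case
  proof (rule n_times_cont_diff_SucI)
    show "((\<lambda>x. f x + g x) has_derivative (\<lambda>h. frechet_derivative f (at x) h + frechet_derivative g (at x) h)) (at x)" for x
      using Suc.prems[THEN n_times_cont_diff_has_derivative] by (rule has_derivative_add)
  qed (use Suc in auto)
qed (simp add: continuous_on_add)

lemma n_times_cont_diff_mult: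
  "n_times_cont_diff n f \<Longrightarrow> n_times_cont_diff n g \<Longrightarrow> n_times_cont_diff n (\<lambda>x. f x * g x)"
proof (induction n arbitrary: f g)
  case (Suc n)
  show ?case
  proof (rule n_times_cont_diff_SucI)
    show "((\<lambda>x. f x * g x) has_derivative
        (\<lambda>h. f x * frechet_derivative g (at x) h + frechet_derivative f (at x) h * g x)) (at x)" for x
      using Suc.prems[THEN n_times_cont_diff_has_derivative] by (rule has_derivative_mult)
    show "n_times_cont_diff n (\<lambda>x. f x * frechet_derivative g (at x) b + frechet_derivative f (at x) b * g x)"
      if "b \<in> Basis" for b
      using Suc.prems that by (intro n_times_cont_diff_add Suc.IH) (auto intro: n_times_cont_diff_SucD)
  qed
qed (simp add: continuous_on_mult)

lemma n_times_cont_diff_sum: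
  "(\<And>i. i \<in> I \<Longrightarrow> n_times_cont_diff n (f i)) \<Longrightarrow> n_times_cont_diff n (\<lambda>x. \<Sum>i\<in>I. f i x)"
  by (induction I rule: infinite_finite_induct) (auto intro: n_times_cont_diff_add)

lemma n_times_cont_diff_prod:
  "(\<And>i. i \<in> I \<Longrightarrow> n_times_cont_diff n (f i)) \<Longrightarrow> n_times_cont_diff n (\<lambda>x. \<Prod>i\<in>I. f i x)"
  by (induction I rule: infinite_finite_induct) (auto intro: n_times_cont_diff_mult)

lemma n_times_cont_diff_diff:
  assumes "n_times_cont_diff n f" "n_times_cont_diff n g"
  shows "n_times_cont_diff n (\<lambda>x. f x - g x)"
  using n_times_cont_diff_add[OF assms(1) n_times_cont_diff_mult[OF n_times_cont_diff_const[of n "-1"] assms(2)]]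
  by simp

lemma n_times_cont_diff_power:
  "n_times_cont_diff n f \<Longrightarrow> n_times_cont_diff n (\<lambda>x. f x ^ k)"
  by (induction k) (auto intro: n_times_cont_diff_mult)

text \<open>\<open>n_times_cont_diff\<close> concerns real-valued functions, so smoothness of
  \<open>g\<close> is asked of its coordinates. By the chain rule a partial derivative of the
  composition is a sum of products of derivatives of these coordinates with partial derivatives of
  \<open>f\<close> taken at \<open>g x\<close>; the induction hypothesis covers the latter because
  \<open>f\<close> varies.\<close>

lemma n_times_cont_diff_compose:
  fixes g :: "'a::euclidean_space \<Rightarrow> 'b::euclidean_space"
  shows "n_times_cont_diff n f \<Longrightarrow> (\<And>c. c \<in> Basis \<Longrightarrow> n_times_cont_diff n (\<lambda>x. g x \<bullet> c)) \<Longrightarrow>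
    n_times_cont_diff n (\<lambda>x. f (g x))"
proof (induction n arbitrary: f)
  case 0
  then have "continuous_on UNIV g" "continuous_on UNIV f"
    by (auto simp: continuous_on_componentwise[of _ g])
  then show ?case by (auto intro: continuous_on_compose2)
next
  case (Suc n)
  define g' where "g' x h = (\<Sum>c\<in>Basis. frechet_derivative (\<lambda>x. g x \<bullet> c) (at x) h *\<^sub>R c)" for x h
  have g': "(g has_derivative g' x) (at x)" for x
    by (subst has_derivative_componentwise_within)
       (use Suc.prems(2)[THEN n_times_cont_diff_has_derivative] in \<open>auto simp: g'_def inner_sum_left_Basis\<close>)
  show ?case
  proof (rule n_times_cont_diff_SucI)
    note f' = n_times_cont_diff_has_derivative[OF Suc.prems(1)]
    show "((\<lambda>x. f (g x)) has_derivative
        (\<lambda>h. \<Sum>c\<in>Basis. frechet_derivative (\<lambda>x. g x \<bullet> c) (at x) h * frechet_derivative f (at (g x)) c)) (at x)" for x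
    proof -
      have "linear (frechet_derivative f (at (g x)))"
        using f' by (rule has_derivative_linear)
      then have eq: "frechet_derivative f (at (g x)) (g' x h) =
          (\<Sum>c\<in>Basis. frechet_derivative (\<lambda>x. g x \<bullet> c) (at x) h * frechet_derivative f (at (g x)) c)" for h
        by (simp add: g'_def linear_sum linear_cmul)
      then show ?thesis
        using has_derivative_compose[OF g'[of x] f'[of "g x"]] by (simp only: eq)
    qed
    show "n_times_cont_diff n (\<lambda>x. \<Sum>c\<in>Basis. frechet_derivative (\<lambda>x. g x \<bullet> c) (at x) b * frechet_derivative f (at (g x)) c)"
      if "b \<in> Basis" for b
      using Suc.prems that
      by (intro n_times_cont_diff_sum n_times_cont_diff_mult Suc.IH[where f = "\<lambda>y. frechet_derivative f (at y) c" for c])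
         (auto intro: n_times_cont_diff_SucD)
  qed
qed

text \<open>The functions \<open>x\<^sup>-\<^sup>k e\<^sup>-\<^sup>1\<^sup>/\<^sup>x\<close> on \<open>x > 0\<close>: their derivatives stay in the span of the family.\<close>

definition flat_exp :: "nat \<Rightarrow> real \<Rightarrow> real" where
  "flat_exp k x = (if x > 0 then inverse x ^ k * exp (- inverse x) else 0)"

text \<open>In the variable \<open>1/x\<close> the exponential dominates every power; on the left
  the function is constantly 0.\<close>

lemma flat_exp_tendsto_0: "(flat_exp k \<longlongrightarrow> 0) (at 0)"
proof -
  have "((\<lambda>x. inverse x ^ k / exp (inverse x)) \<longlongrightarrow> (0::real)) (at_right 0)"
    using tendsto_power_div_exp_0 filterlim_inverse_at_top_right by (rule filterlim_compose)
  moreover have "\<forall>\<^sub>F x in at_right 0. inverse x ^ k / exp (inverse x) = flat_exp k x"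
    by (auto simp: eventually_at_filter flat_exp_def exp_minus divide_inverse)
  ultimately have "(flat_exp k \<longlongrightarrow> 0) (at_right 0)"
    by (rule Lim_transform_eventually)
  moreover have "\<forall>\<^sub>F x in at_left 0. 0 = flat_exp k x"
    by (auto simp: eventually_at_filter flat_exp_def)
  then have "(flat_exp k \<longlongrightarrow> 0) (at_left 0)"
    by (rule Lim_transform_eventually[OF tendsto_const])
  ultimately show ?thesis by (simp add: filterlim_at_split)
qed

lemma flat_exp_has_derivative:
  "(flat_exp k has_real_derivative (- real k * flat_exp (Suc k) x + flat_exp (Suc (Suc k)) x)) (at x)"
proof -
  consider "x > 0" | "x < 0" | "x = 0" by linarith
  then show ?thesis
  proof cases
    case 1
    let ?y = "inverse x"
    have "((\<lambda>x. inverse x ^ k * exp (- inverse x)) has_real_derivative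
       real k * ?y ^ (k - 1) * - (?y * ?y) * exp (- ?y) + ?y ^ k * (exp (- ?y) * (?y * ?y))) (at x)"
      using 1 by (auto intro!: derivative_eq_intros)
    also have "real k * ?y ^ (k - 1) * - (?y * ?y) * exp (- ?y) + ?y ^ k * (exp (- ?y) * (?y * ?y)) =
        - real k * flat_exp (Suc k) x + flat_exp (Suc (Suc k)) x"
      using 1 by (cases k) (simp_all add: flat_exp_def algebra_simps)
    finally have "((\<lambda>x. inverse x ^ k * exp (- inverse x)) has_real_derivative
       (- real k * flat_exp (Suc k) x + flat_exp (Suc (Suc k)) x)) (at x)" .
    moreover have "\<forall>\<^sub>F y in nhds x. inverse y ^ k * exp (- inverse y) = flat_exp k y"
      using eventually_nhds_in_open[of "{0<..}" x] 1 by (auto elim!: eventually_mono simp: flat_exp_def)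
    ultimately show ?thesis by (subst DERIV_cong_ev[OF refl _ refl]) (auto elim: eventually_mono)
  next
    case 2
    have "\<forall>\<^sub>F y in nhds x. flat_exp k y = 0"
      using eventually_nhds_in_open[of "{..<0}" x] 2 by (auto elim!: eventually_mono simp: flat_exp_def)
    then show ?thesis
      using 2 by (subst DERIV_cong_ev[OF refl _ refl]) (auto simp: flat_exp_def)
  next
    case 3
    \<comment> \<open>The difference quotient at 0 is the next member of the family, so the
      derivative there is the limit already computed.\<close>
    have "(\<lambda>y. (flat_exp k y - flat_exp k 0) / (y - 0)) = flat_exp (Suc k)"
      by (auto simp: flat_exp_def divide_inverse)
    then show ?thesis
      using 3 flat_exp_tendsto_0[of "Suc k"] by (simp add: has_field_derivative_iff flat_exp_def[of _ 0])
  qed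
qed

lemma n_times_cont_diff_flat_exp: "n_times_cont_diff n (flat_exp k)"
proof (induction n arbitrary: k)
  case 0
  show ?case
    using flat_exp_has_derivative by (auto intro!: continuous_at_imp_continuous_on DERIV_isCont)
next
  case (Suc n)
  show ?case
  proof (rule n_times_cont_diff_SucI)
    show "(flat_exp k has_derivative (*) (- real k * flat_exp (Suc k) x + flat_exp (Suc (Suc k)) x)) (at x)" for x
      using flat_exp_has_derivative by (simp add: has_field_derivative_def)
  qed (intro n_times_cont_diff_mult n_times_cont_diff_add n_times_cont_diff_const Suc)
qed

lemma flat_exp_0: "0 \<le> flat_exp 0 x" "flat_exp 0 x \<le> 1" "0 < flat_exp 0 x \<longleftrightarrow> 0 < x"
  by (auto simp: flat_exp_def)

section \<open>Smooth functions increasing to the indicator of a box\<close>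

text \<open>The inner product over the basis lies in \<open>[0,1]\<close> and is positive exactly on
  the open box. Taking the power therefore gives pointwise monotone convergence while the supports
  stay in one fixed compact box.\<close>

definition box_bump :: "'a::euclidean_space \<Rightarrow> 'a \<Rightarrow> nat \<Rightarrow> 'a \<Rightarrow> real" where
  "box_bump a b n x = 1 - (1 - (\<Prod>i\<in>Basis. flat_exp 0 (x \<bullet> i - a \<bullet> i) * flat_exp 0 (b \<bullet> i - x \<bullet> i))) ^ n"

lemma box_bump_core:
  fixes a b x :: "'a::euclidean_space"
  defines "g \<equiv> (\<Prod>i\<in>Basis. flat_exp 0 (x \<bullet> i - a \<bullet> i) * flat_exp 0 (b \<bullet> i - x \<bullet> i))"
  shows "0 \<le> g" "g \<le> 1" "x \<in> box a b \<Longrightarrow> 0 < g" "x \<notin> box a b \<Longrightarrow> g = 0"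
proof -
  show "0 \<le> g" unfolding g_def by (intro prod_nonneg mult_nonneg_nonneg flat_exp_0)
  show "g \<le> 1" unfolding g_def by (intro prod_le_1 conjI mult_nonneg_nonneg mult_le_one flat_exp_0)
  show "0 < g" if "x \<in> box a b"
    unfolding g_def using that by (intro prod_pos mult_pos_pos) (auto simp: flat_exp_0 box_def)
  show "g = 0" if xb: "x \<notin> box a b"
  proof -
    obtain i where i: "i \<in> Basis" "\<not> (a \<bullet> i < x \<bullet> i \<and> x \<bullet> i < b \<bullet> i)"
      using xb by (auto simp: box_def)
    then have "flat_exp 0 (x \<bullet> i - a \<bullet> i) * flat_exp 0 (b \<bullet> i - x \<bullet> i) = 0"
      by (auto simp: flat_exp_def)
    then show ?thesis unfolding g_def using i(1) by (intro prod_zero) auto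
  qed
qed

lemma box_bump_bounds: "0 \<le> box_bump a b n x" "box_bump a b n x \<le> 1" "x \<notin> box a b \<Longrightarrow> box_bump a b n x = 0"
  using box_bump_core(1,2)[of x a b] by (simp_all add: box_bump_def power_le_one box_bump_core(4))

lemma box_bump_mono: "incseq (\<lambda>n. box_bump a b n x)"
  using box_bump_core[of x a b] by (auto simp: box_bump_def incseq_def intro!: power_decreasing)

lemma box_bump_tendsto: "(\<lambda>n. box_bump a b n x) \<longlonglongrightarrow> indicator (box a b) x"
proof (cases "x \<in> box a b")
  case True
  let ?g = "\<Prod>i\<in>Basis. flat_exp 0 (x \<bullet> i - a \<bullet> i) * flat_exp 0 (b \<bullet> i - x \<bullet> i)"
  have "(\<lambda>n. 1 - (1 - ?g) ^ n) \<longlonglongrightarrow> 1 - 0"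
    using box_bump_core[of x a b] True by (intro tendsto_intros LIMSEQ_realpow_zero) auto
  then show ?thesis using True by (simp add: box_bump_def)
qed (simp add: box_bump_bounds)

lemma smooth_compact_support_box_bump: "smooth_compact_support (box_bump a b n)"
  unfolding smooth_compact_support_def
proof (intro conjI allI)
  fix k
  have lin: "n_times_cont_diff k (\<lambda>x. (x \<bullet> i))" for i :: 'a
    by (intro n_times_cont_diff_linear bounded_linear_inner_left)
  have "n_times_cont_diff k (\<lambda>x. flat_exp 0 (x \<bullet> i - a \<bullet> i))" "n_times_cont_diff k (\<lambda>x. flat_exp 0 (b \<bullet> i - x \<bullet> i))" for i
    using n_times_cont_diff_compose[OF n_times_cont_diff_flat_exp, of k "\<lambda>x. x \<bullet> i - a \<bullet> i" 0]
      n_times_cont_diff_compose[OF n_times_cont_diff_flat_exp, of k "\<lambda>x. b \<bullet> i - x \<bullet> i" 0]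
    by (simp_all add: n_times_cont_diff_diff lin)
  then show "n_times_cont_diff k (box_bump a b n)"
    unfolding box_bump_def
    by (intro n_times_cont_diff_diff n_times_cont_diff_power n_times_cont_diff_prod n_times_cont_diff_mult) auto
next
  have "{x. box_bump a b n x \<noteq> 0} \<subseteq> cbox a b"
    using box_bump_bounds(3)[of _ a b n] box_subset_cbox by blast
  then show "compact (closure {x. box_bump a b n x \<noteq> 0})"
    by (meson bounded_cbox bounded_closure bounded_subset closed_closure compact_eq_bounded_closed)
qed

section \<open>Properness of the Hilbert map and admissible test functions\<close>

lemma norm_le_sum_norm_nth: "norm (v :: 'a::real_normed_vector ^ 'n::finite) \<le> (\<Sum>i\<in>UNIV. norm (v $ i))"
  unfolding norm_vec_def by (rule L2_set_le_sum) simp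

text \<open>The diagonal Gram entries are the squared lengths, so they bound all vectors. This
  properness gives compact supports after pulling back and finite mass of boxes under the
  push-forward.\<close>

lemma bounded_vimage_hilbert_map:
  assumes "bounded S"
  shows "bounded (hilbert_map -` S :: (real^'m::finite^'k::finite) set)"
proof -
  obtain B where B: "\<And>u. u \<in> S \<Longrightarrow> norm u \<le> B" using assms by (auto simp: bounded_iff)
  have "norm v \<le> real CARD('k) * sqrt B" if "hilbert_map v \<in> S" for v :: "real^'m^'k"
  proof -
    have "norm (v $ i) \<le> sqrt B" for i
    proof -
      have "(norm (v $ i))\<^sup>2 = hilbert_map v $ Upair i i" by (simp add: power2_norm_eq_inner)
      also have "\<dots> \<le> B" using B[OF that] component_le_norm_cart[of "hilbert_map v" "Upair i i"] by linarith
      finally show ?thesis by (rule real_le_rsqrt)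
    qed
    then have "(\<Sum>i\<in>UNIV. norm (v $ i)) \<le> (\<Sum>i\<in>(UNIV::'k set). sqrt B)" by (intro sum_mono)
    then show ?thesis using norm_le_sum_norm_nth[of v] by simp
  qed
  then show ?thesis by (auto simp: bounded_iff)
qed

lemma smooth_compact_support_hilbert_map:
  assumes "smooth_compact_support F"
  shows "smooth_compact_support (\<lambda>v :: real^'m::finite^'k::finite. F (hilbert_map v))"
  unfolding smooth_compact_support_def
proof (intro conjI allI)
  fix n
  have "n_times_cont_diff n (\<lambda>v :: real^'m^'k. hilbert_map v $ p)" for p
  proof (cases p)
    case (Upair i j)
    have "bounded_linear (\<lambda>v :: real^'m^'k. v $ i $ l)" for i l
      by (intro bounded_linear_compose[OF bounded_linear_vec_nth] bounded_linear_vec_nth)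
    then have "n_times_cont_diff n (\<lambda>v :: real^'m^'k. \<Sum>l\<in>UNIV. v $ i $ l * v $ j $ l)"
      by (intro n_times_cont_diff_sum n_times_cont_diff_mult n_times_cont_diff_linear)
    then show ?thesis by (simp add: Upair inner_vec_def)
  qed
  then have "n_times_cont_diff n (\<lambda>v :: real^'m^'k. hilbert_map v \<bullet> c)" if "c \<in> Basis" for c
    using that by (auto simp: Basis_vec_def inner_axis)
  then show "n_times_cont_diff n (\<lambda>v :: real^'m^'k. F (hilbert_map v))"
    using assms n_times_cont_diff_compose[of n F "hilbert_map :: real^'m^'k \<Rightarrow> _"]
    by (simp add: smooth_compact_support_def)
next
  have "bounded {u. F u \<noteq> 0}"
    using assms closure_subset[of "{u. F u \<noteq> 0}"]
    by (auto simp: smooth_compact_support_def intro: bounded_subset compact_imp_bounded)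
  then have "bounded (hilbert_map -` {u. F u \<noteq> 0} :: (real^'m^'k) set)"
    by (rule bounded_vimage_hilbert_map)
  then show "compact (closure {v :: real^'m^'k. F (hilbert_map v) \<noteq> 0})"
    by (simp add: vimage_def compact_eq_bounded_closed bounded_closure)
qed

lemma SO_invariant_hilbert_map: "SO_invariant (\<lambda>v :: real^'m::finite^'k::finite. F (hilbert_map v))"
  unfolding SO_invariant_def
proof (intro allI impI)
  fix A :: "real^'m^'m" and v :: "real^'m^'k"
  assume "rotation_matrix A"
  then have "orthogonal_matrix A" by (simp add: rotation_matrix_def)
  then have "orthogonal_transformation ((*v) A)"
    using orthogonal_transformation_matrix[of "(*v) A"] by simp
  then have "hilbert_map (\<chi> i. A *v (v $ i)) $ p = hilbert_map v $ p" for p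
    by (cases p) (simp add: orthogonal_transformation_def)
  then have "hilbert_map (\<chi> i. A *v (v $ i)) = hilbert_map v"
    by (simp add: vec_eq_iff)
  then show "F (hilbert_map (\<chi> i. A *v (v $ i))) = F (hilbert_map v)" by simp
qed

lemma smooth_compact_support_integrable:
  assumes "smooth_compact_support f"
  shows "integrable lborel f"
proof -
  have "n_times_cont_diff 0 f" using assms unfolding smooth_compact_support_def by blast
  then have "continuous_on (closure {x. f x \<noteq> 0}) f" by (auto intro: continuous_on_subset)
  then have "integrable lborel (\<lambda>x. indicator (closure {x. f x \<noteq> 0}) x *\<^sub>R f x)"
    using assms by (intro borel_integrable_compact) (auto simp: smooth_compact_support_def)
  moreover have "(\<lambda>x. indicator (closure {x. f x \<noteq> 0}) x *\<^sub>R f x) = f"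
    using closure_subset[of "{x. f x \<noteq> 0}"] by (auto simp: fun_eq_iff indicator_def)
  ultimately show ?thesis by simp
qed

subsection \<open>Volumes and the Hilbert measure\<close>

text \<open>The fibration of \<open>O_(n+1)\<close> over the sphere \<open>S^n\<close> with fibre
  \<open>O_n\<close>, read off from the normalisation: the two binomial coefficients differ by
  \<open>n + 1\<close>, which supplies \<open>sqrt pi ^ Suc n\<close>.\<close>

lemma orthogonal_group_vol_Suc: "orthogonal_group_vol (Suc n) = orthogonal_group_vol n * sphere_vol n"
proof -
  have "pi powr ((real n + 1) / 2) = sqrt pi ^ Suc n"
    by (simp add: powr_half_sqrt[symmetric] powr_powr powr_realpow[symmetric] add_divide_distrib powr_add add.commute)
  moreover have "Suc (Suc n) choose 2 = (Suc n choose 2) + Suc n"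
    by (simp add: numeral_2_eq_2)
  ultimately show ?thesis
    by (simp add: orthogonal_group_vol_def sphere_vol_def power_add add.commute)
qed

lemma orthogonal_group_vol_pos: "orthogonal_group_vol n > 0"
  unfolding orthogonal_group_vol_def
  by (intro divide_pos_pos mult_pos_pos prod_pos Gamma_real_pos) auto

text \<open>The quotient telescopes: lowering the group index to \<open>m - j\<close> splits off the
  sphere of dimension \<open>m - j\<close>.\<close>

lemma stiefel_vol_eq_prod:
  assumes "k \<le> m"
  shows "stiefel_vol m k = (\<Prod>j=1..k. sphere_vol (m - j))"
proof -
  have "orthogonal_group_vol m = orthogonal_group_vol (m - k) * (\<Prod>j=1..k. sphere_vol (m - j))"
    using assms
  proof (induction k)
    case (Suc k)
    then have "m - k = Suc (m - Suc k)" by simp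
    then have "orthogonal_group_vol (m - k) = orthogonal_group_vol (m - Suc k) * sphere_vol (m - Suc k)"
      by (simp only: orthogonal_group_vol_Suc)
    with Suc show ?case by simp
  qed simp
  then show ?thesis
    using orthogonal_group_vol_pos[of "m - k"] by (simp add: stiefel_vol_def)
qed

section \<open>Existence and uniqueness of the measure on the image\<close>

text \<open>\<open>density_on_image\<close> lives on a restricted space. Cutting the densities off
  by an indicator allows the comparison to be made on the whole space, where boxes generate the
  Borel sets.\<close>

lemma density_on_image_cong:
  fixes l l' :: "real^('k::finite uprod) \<Rightarrow> real"
  assumes [measurable]: "l \<in> borel_measurable borel" "l' \<in> borel_measurable borel"
    and eq: "density lborel (\<lambda>u. ennreal (l u) * indicator (hilbert_image TYPE('m::finite)) u) =
      density lborel (\<lambda>u. ennreal (l' u) * indicator (hilbert_image TYPE('m)) u)"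
  shows "density_on_image TYPE('m) l = density_on_image TYPE('m) l'"
proof (rule measure_eqI)
  let ?W = "hilbert_image TYPE('m) :: (real^('k uprod)) set"
  have W[measurable]: "?W \<in> sets borel" by (rule measurable_hilbert_image)
  fix A assume "A \<in> sets (density_on_image TYPE('m) l)"
  then have AW: "A \<in> sets (restrict_space lborel ?W)" by (simp add: density_on_image_def)
  then have A[measurable]: "A \<in> sets borel" using W by (auto simp: sets_restrict_space)
  have em: "emeasure (density_on_image TYPE('m) h) A = emeasure (density lborel (\<lambda>u. ennreal (h u) * indicator ?W u)) A"
    if [measurable]: "h \<in> borel_measurable borel" for h :: "real^('k uprod) \<Rightarrow> real"
  proof -
    have "h \<in> borel_measurable (restrict_space lborel ?W)"
      by (rule measurable_restrict_space1) simp
    then have "emeasure (density_on_image TYPE('m) h) A = (\<integral>\<^sup>+u. ennreal (h u) * indicator A u \<partial>restrict_space lborel ?W)"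
      unfolding density_on_image_def using AW by (subst emeasure_density) auto
    also have "\<dots> = (\<integral>\<^sup>+u. ennreal (h u) * indicator A u * indicator ?W u \<partial>lborel)"
      using W by (subst nn_integral_restrict_space) auto
    also have "\<dots> = emeasure (density lborel (\<lambda>u. ennreal (h u) * indicator ?W u)) A"
      by (subst emeasure_density) (auto simp: mult_ac)
    finally show ?thesis .
  qed
  show "emeasure (density_on_image TYPE('m) l) A = emeasure (density_on_image TYPE('m) l') A"
    by (simp add: em eq)
qed (simp add: density_on_image_def)

lemma measurable_hilbert_density [measurable]: "hilbert_density T \<in> borel_measurable borel"
  unfolding hilbert_density_def gram_power_def by measurable

lemma distr_hilbert_map:
  assumes "CARD('k::finite) < CARD('m::finite)"
  shows "distr lborel borel (hilbert_map :: real^'m^'k \<Rightarrow> _) =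
    density lborel (\<lambda>u. ennreal (hilbert_density TYPE('m) u) * indicator (hilbert_image TYPE('m)) u)"
proof (rule measure_eqI)
  fix A assume "A \<in> sets (distr lborel borel (hilbert_map :: real^'m^'k \<Rightarrow> _))"
  then have A[measurable]: "A \<in> sets borel" by simp
  note measurable_hilbert_image[measurable]
  have ind: "(indicator A :: _ \<Rightarrow> ennreal) \<in> borel_measurable borel" by simp
  have "emeasure (distr lborel borel (hilbert_map :: real^'m^'k \<Rightarrow> _)) A = (\<integral>\<^sup>+v. indicator A (hilbert_map (v :: real^'m^'k)) \<partial>lborel)"
  proof -
    have "(\<integral>\<^sup>+u. indicator A u \<partial>distr lborel borel (hilbert_map :: real^'m^'k \<Rightarrow> _)) =
        (\<integral>\<^sup>+v. indicator A (hilbert_map (v :: real^'m^'k)) \<partial>lborel)"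
      by (rule nn_integral_distr) measurable
    then show ?thesis by simp
  qed
  also have "\<dots> = (\<integral>\<^sup>+u. indicator A u * (ennreal (hilbert_density TYPE('m) u) * indicator (hilbert_image TYPE('m)) u) \<partial>lborel)"
    using hilbert_map_distribution[OF assms] ind by blast
  also have "\<dots> = emeasure (density lborel (\<lambda>u. ennreal (hilbert_density TYPE('m) u) * indicator (hilbert_image TYPE('m)) u)) A"
    by (subst emeasure_density) (auto simp: mult.commute)
  finally show "emeasure (distr lborel borel (hilbert_map :: real^'m^'k \<Rightarrow> _)) A =
    emeasure (density lborel (\<lambda>u. ennreal (hilbert_density TYPE('m) u) * indicator (hilbert_image TYPE('m)) u)) A" .
qed simp

lemma is_hilbert_measure_density:
  assumes km: "CARD('k::finite) < CARD('m::finite)"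
  shows "is_hilbert_measure TYPE('m) (density_on_image TYPE('m) (hilbert_density TYPE('m) :: real^('k uprod) \<Rightarrow> real))"
proof -
  let ?W = "hilbert_image TYPE('m) :: (real^('k uprod)) set"
  note measurable_hilbert_image[measurable]
  \<comment> \<open>Off the image the determinant may be negative, and odd powers of its
    \<open>sqrt\<close> are then negative too, whereas \<open>is_hilbert_measure\<close> asks for a
    density that is nonnegative everywhere. Truncation leaves the \<open>ennreal\<close> value
    unchanged.\<close>
  define l :: "real^('k uprod) \<Rightarrow> real" where "l u = max 0 (hilbert_density TYPE('m) u)" for u
  have l[measurable]: "l \<in> borel_measurable borel" unfolding l_def by measurable
  have l_nonneg: "0 \<le> l u" for u by (simp add: l_def)
  have l_eq: "ennreal (hilbert_density TYPE('m) u) = ennreal (l u)" for u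
    by (simp add: l_def max_def ennreal_neg)
  have dens: "distr lborel borel (hilbert_map :: real^'m^'k \<Rightarrow> _) = density lborel (\<lambda>u. ennreal (indicator ?W u * l u))"
    unfolding distr_hilbert_map[OF km] l_eq
    by (intro arg_cong[where f = "density lborel"] ext) (simp add: indicator_def)
  have "density_on_image TYPE('m) (hilbert_density TYPE('m) :: real^('k uprod) \<Rightarrow> real) = density_on_image TYPE('m) l"
    by (rule density_on_image_cong) (simp_all add: l_eq)
  moreover have "\<forall>(f :: real^'m^'k \<Rightarrow> real) F. smooth_compact_support f \<and> SO_invariant f \<and>
      smooth_compact_support F \<and> (\<forall>v. f v = F (hilbert_map v)) \<longrightarrow>
      set_integrable lborel ?W (\<lambda>u. F u * l u) \<and> (LINT v|lborel. f v) = (LINT u:?W|lborel. F u * l u)"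
  proof (intro allI impI; elim conjE)
    fix f :: "real^'m^'k \<Rightarrow> real" and F
    assume F: "smooth_compact_support F" and f: "smooth_compact_support f" "\<forall>v. f v = F (hilbert_map v)"
    have "n_times_cont_diff 0 F" using F unfolding smooth_compact_support_def by blast
    then have [measurable]: "F \<in> borel_measurable borel" by (simp add: borel_measurable_continuous_onI)
    have f_eq: "f = (\<lambda>v. F (hilbert_map v))" using f(2) by blast
    have "integrable (distr lborel borel (hilbert_map :: real^'m^'k \<Rightarrow> _)) F"
      using smooth_compact_support_integrable[OF f(1)] by (simp add: integrable_distr_eq f_eq)
    then have "integrable lborel (\<lambda>u. (indicator ?W u * l u) *\<^sub>R F u)"
      unfolding dens by (subst (asm) integrable_density) (auto simp: l_def)
    moreover have "(LINT v|lborel. f v) = (LINT u|lborel. (indicator ?W u * l u) *\<^sub>R F u)"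
    proof -
      have "(LINT v|lborel. f v) = (LINT u|distr lborel borel (hilbert_map :: real^'m^'k \<Rightarrow> _). F u)"
        unfolding f_eq by (subst integral_distr) auto
      also have "\<dots> = (LINT u|lborel. (indicator ?W u * l u) *\<^sub>R F u)"
        unfolding dens by (subst integral_density) (auto simp: l_def)
      finally show ?thesis .
    qed
    ultimately show "set_integrable lborel ?W (\<lambda>u. F u * l u) \<and> (LINT v|lborel. f v) = (LINT u:?W|lborel. F u * l u)"
      by (simp add: set_integrable_def set_lebesgue_integral_def mult_ac)
  qed
  moreover have "l \<in> borel_measurable lborel" by simp
  ultimately show ?thesis
    unfolding is_hilbert_measure_def using l_nonneg by blast
qed

text \<open>Test functions pulled back from the target suffice: by properness, every smooth
  compactly supported \<open>F\<close> yields an admissible \<open>f\<close>.\<close>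

lemma is_hilbert_measure_unique:
  fixes M :: "(real^('k::finite uprod)) measure"
  assumes km: "CARD('k) < CARD('m::finite)" and M: "is_hilbert_measure TYPE('m) M"
  shows "M = density_on_image TYPE('m) (hilbert_density TYPE('m))"
proof -
  let ?W = "hilbert_image TYPE('m) :: (real^('k uprod)) set"
  let ?h = "hilbert_map :: real^'m^'k \<Rightarrow> real^('k uprod)"
  note measurable_hilbert_image[measurable]
  obtain l :: "real^('k uprod) \<Rightarrow> real" where l_all: "l \<in> borel_measurable lborel" "\<forall>u. 0 \<le> l u" "M = density_on_image TYPE('m) l"
    and int: "\<forall>(f :: real^'m^'k \<Rightarrow> real) F. smooth_compact_support f \<and> SO_invariant f \<and>
      smooth_compact_support F \<and> (\<forall>v. f v = F (hilbert_map v)) \<longrightarrow>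
      set_integrable lborel ?W (\<lambda>u. F u * l u) \<and> (LINT v|lborel. f v) = (LINT u:?W|lborel. F u * l u)"
    using M unfolding is_hilbert_measure_def by blast
  then have l: "l \<in> borel_measurable borel" "\<And>u. 0 \<le> l u" "M = density_on_image TYPE('m) l"
    by simp_all
  note [measurable] = l(1)
  let ?N = "density lborel (\<lambda>u. ennreal (l u) * indicator ?W u)"
  \<comment> \<open>Bumps and \<open>l\<close> are nonnegative, so the equation between Bochner
    integrals becomes one between nonnegative integrals, ready for monotone convergence.\<close>
  have bump: "(\<integral>\<^sup>+v. ennreal (box_bump a b n (?h v)) \<partial>lborel) =
    (\<integral>\<^sup>+u. ennreal (box_bump a b n u) * (ennreal (l u) * indicator ?W u) \<partial>lborel)" for a b n
  proof -
    let ?F = "box_bump a b n"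
    have F: "smooth_compact_support ?F" by (rule smooth_compact_support_box_bump)
    have i: "set_integrable lborel ?W (\<lambda>u. ?F u * l u)"
      "(LINT v|lborel. ?F (?h v)) = (LINT u:?W|lborel. ?F u * l u)"
      using int smooth_compact_support_hilbert_map[OF F, where 'm = 'm] SO_invariant_hilbert_map[where F = ?F and 'm = 'm] F by blast+
    have "(\<integral>\<^sup>+v. ennreal (?F (?h v)) \<partial>lborel) = ennreal (LINT v|lborel. ?F (?h v))"
      using smooth_compact_support_integrable[OF smooth_compact_support_hilbert_map[OF F]]
      by (intro nn_integral_eq_integral) (auto simp: box_bump_bounds)
    also have "\<dots> = (\<integral>\<^sup>+u. ennreal (indicator ?W u *\<^sub>R (?F u * l u)) \<partial>lborel)"
      using i unfolding set_integrable_def set_lebesgue_integral_def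
      by (subst nn_integral_eq_integral) (auto simp: box_bump_bounds l)
    also have "\<dots> = (\<integral>\<^sup>+u. ennreal (?F u) * (ennreal (l u) * indicator ?W u) \<partial>lborel)"
      by (intro nn_integral_cong) (auto simp: box_bump_bounds l ennreal_mult indicator_def)
    finally show ?thesis .
  qed
  have bump_meas[measurable]: "box_bump a b n \<in> borel_measurable borel" for a b :: "real^('k uprod)" and n
  proof -
    have "n_times_cont_diff 0 (box_bump a b n)"
      using smooth_compact_support_box_bump[of a b n] unfolding smooth_compact_support_def by blast
    then show ?thesis by (simp add: borel_measurable_continuous_onI)
  qed
  have box: "emeasure (distr lborel borel ?h) (box a b) = emeasure ?N (box a b)" for a b
  proof -
    have lim: "(\<lambda>n. ennreal (box_bump a b n u)) \<longlonglongrightarrow> indicator (box a b) u" for u :: "real^('k uprod)"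
      using tendsto_ennrealI[OF box_bump_tendsto[of a b u]] by (simp add: ennreal_indicator)
    have inc: "m \<le> n \<Longrightarrow> ennreal (box_bump a b m u) \<le> ennreal (box_bump a b n u)" for m n and u :: "real^('k uprod)"
      using box_bump_mono[of a b u] by (auto simp: incseq_def intro: ennreal_leI)
    have "(\<lambda>n. \<integral>\<^sup>+v. ennreal (box_bump a b n (?h v)) \<partial>lborel) \<longlonglongrightarrow> (\<integral>\<^sup>+v. indicator (box a b) (?h v) \<partial>lborel)"
      by (rule nn_integral_LIMSEQ) (auto simp: incseq_def le_fun_def inc lim)
    moreover have "(\<lambda>n. \<integral>\<^sup>+u. ennreal (box_bump a b n u) * (ennreal (l u) * indicator ?W u) \<partial>lborel) \<longlonglongrightarrow>
       (\<integral>\<^sup>+u. indicator (box a b) u * (ennreal (l u) * indicator ?W u) \<partial>lborel)"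
    proof (rule nn_integral_LIMSEQ)
      show "(\<lambda>n. ennreal (box_bump a b n u) * (ennreal (l u) * indicator ?W u)) \<longlonglongrightarrow>
          indicator (box a b) u * (ennreal (l u) * indicator ?W u)" for u
        by (intro tendsto_mult_ennreal lim tendsto_const) (auto simp: indicator_def)
    qed (auto simp: incseq_def le_fun_def intro: mult_right_mono inc)
    ultimately have "(\<integral>\<^sup>+v. indicator (box a b) (?h v) \<partial>lborel) = (\<integral>\<^sup>+u. indicator (box a b) u * (ennreal (l u) * indicator ?W u) \<partial>lborel)"
      unfolding bump by (rule LIMSEQ_unique)
    moreover have "(\<integral>\<^sup>+v. indicator (box a b) (?h v) \<partial>lborel) = emeasure (distr lborel borel ?h) (box a b)"
    proof -
      have "(\<integral>\<^sup>+u. indicator (box a b) u \<partial>distr lborel borel ?h) = (\<integral>\<^sup>+v. indicator (box a b) (?h v) \<partial>lborel)"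
        by (rule nn_integral_distr) measurable
      then show ?thesis by simp
    qed
    ultimately show ?thesis
      by (simp add: emeasure_density mult.commute)
  qed
  have "distr lborel borel ?h = ?N"
  proof (rule measure_eqI_generator_eq)
    let ?E = "range (\<lambda>(a, b). box a b :: (real^('k uprod)) set)"
    show "Int_stable ?E" by (auto simp: Int_stable_def box_Int_box)
    show "sets (distr lborel borel ?h) = sigma_sets UNIV ?E" "sets ?N = sigma_sets UNIV ?E"
      by (simp_all add: borel_eq_box)
    show "emeasure (distr lborel borel ?h) X = emeasure ?N X" if "X \<in> ?E" for X
      using that box by auto
    show "range (\<lambda>n. box (- (real n *\<^sub>R One)) (real n *\<^sub>R One)) \<subseteq> ?E" by auto
    show "(\<Union>n. box (- (real n *\<^sub>R One)) (real n *\<^sub>R One)) = (UNIV :: (real^('k uprod)) set)"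
      by (rule UN_box_eq_UNIV)
    \<comment> \<open>Finiteness on boxes is read off from the push-forward side, where the preimage
      of a box is bounded.\<close>
    show "emeasure (distr lborel borel ?h) (box (- (real n *\<^sub>R One)) (real n *\<^sub>R One)) \<noteq> \<infinity>" for n
    proof -
      have "bounded (?h -` box (- (real n *\<^sub>R One)) (real n *\<^sub>R One))"
        by (intro bounded_vimage_hilbert_map bounded_box)
      then show ?thesis using emeasure_bounded_finite[of "?h -` box (- (real n *\<^sub>R One)) (real n *\<^sub>R One)"]
        by (simp add: emeasure_distr less_top)
    qed
  qed simp
  then show ?thesis
    unfolding l(3) distr_hilbert_map[OF km] by (intro density_on_image_cong) (simp_all add: l(1))
qed

theorem corollary1p2:
  fixes M :: "(real^('k::finite uprod)) measure"
  assumes "1 \<le> CARD('k)" and "CARD('k) \<le> CARD('m::finite) - 1"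
  shows "(is_hilbert_measure TYPE('m) M \<longleftrightarrow>
            M = density_on_image TYPE('m)
                  (\<lambda>u. gram_power TYPE('m) u / 2 ^ CARD('k) *
                       (\<Prod>j=1..CARD('k). sphere_vol (CARD('m) - j)))) \<and>
         (\<forall>u :: real^('k uprod).
            gram_power TYPE('m) u / 2 ^ CARD('k) *
              (\<Prod>j=1..CARD('k). sphere_vol (CARD('m) - j)) =
            1 / 2 ^ CARD('k) * stiefel_vol (CARD('m)) (CARD('k)) * gram_power TYPE('m) u)"
proof -
  \<comment> \<open>With a positive left side, the bound by the \<open>nat\<close> difference
    \<open>CARD('m) - 1\<close> is a strict inequality.\<close>
  have km: "CARD('k) < CARD('m)" using assms by linarith
  have "(\<lambda>u. gram_power TYPE('m) u / 2 ^ CARD('k) * (\<Prod>j=1..CARD('k). sphere_vol (CARD('m) - j))) =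
    (hilbert_density TYPE('m) :: real^('k uprod) \<Rightarrow> real)"
    by (simp add: hilbert_density_def fun_eq_iff)
  then show ?thesis
    using is_hilbert_measure_density[OF km] is_hilbert_measure_unique[OF km, of M] km
    by (auto simp: stiefel_vol_eq_prod)
qed

end
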